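(* The conditional inequalities ($\mathcal I1$) and ($\mathcal I3$) do not hold for almost entropic points (for four random variables). That is: (1) there exists an almost entropic point in $\mathbb R^{15}$, with coordinates indexed by the non-empty subsets of $\{A,B,C,D\}$, for which $I(A:B|C)=I(A:B)=0$ but $\square_{AB,CD}<0$; (2) there exists an almost entropic point in $\mathbb R^{15}$, with coordinates indexed by the non-empty subsets of $\{A,B,C,D\}$, for which $I(A:B|C)=H(C|A,B)=0$ but $\square_{AB,CD}<0$.
   Context: All random variables are discrete with finite range; $H$ is Shannon entropy. The entropy profile of jointly distributed random variables $\mathcal X=\{X_1,\dots,X_n\}$ is the vector $(H(X))_{\emptyset\ne X\subseteq\mathcal X}\in\mathbb R^{2^n-1}$ of the entropies of all non-empty subtuples. A point of $\mathbb R^{2^n-1}$ is entropic if it is the entropy profile of some distribution, and almost entropic if it lies in the closure of the set of entropic points. For an almost entropic point its coordinates are still denoted $H(A)$, $H(A,B)$, etc., and $H(X|Y)$, $I(X:Y)$, $I(X:Y|Z)$ denote the corresponding linear combinations of coordinates: $H(X|Y)=H(X,Y)-H(Y)$, $I(X:Y)=H(X)+H(Y)-H(X,Y)$, $I(X:Y|Z)=H(X,Z)+H(Y,Z)-H(X,Y,Z)-H(Z)$. Also $\square_{AB,CD}:=I(C:D|A)+I(C:D|B)+I(A:B)-I(C:D)$. ($\mathcal I1$) is the implication: $I(A:B|C)=I(A:B)=0\Rightarrow\square_{AB,CD}\ge0$. ($\mathcal I3$) is the implication: $I(A:B|C)=H(C|A,B)=0\Rightarrow\square_{AB,CD}\ge0$.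 *)

theory Defs
  imports "HOL-Probability.Probability"
begin

text \<open>
  The index set of the coordinates of an entropy profile: the non-empty sets of (indices of)
  random variables. For \<open>n\<close> variables this type has \<open>2 ^ n - 1\<close> elements.
\<close>

typedef 'i neset = "{S :: 'i set. S \<noteq> {}}"
  by auto

instance neset :: (finite) finite
proof
  have "UNIV = Abs_neset ` {S :: 'a set. S \<noteq> {}}"
    by (rule type_definition.Abs_image[OF type_definition_neset, symmetric])
  moreover have "finite (Abs_neset ` {S :: 'a set. S \<noteq> {}})"
    by (intro finite_imageI finite)
  ultimately show "finite (UNIV :: 'a neset set)"
    by simp
qed

lemma card_neset: "CARD('i::finite neset) = 2 ^ CARD('i) - 1"
proof -
  have "CARD('i neset) = card {S :: 'i set. S \<noteq> {}}"
    by (rule type_definition.card[OF type_definition_neset])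
  also have "{S :: 'i set. S \<noteq> {}} = Pow UNIV - {{}}"
    by auto
  also have "card \<dots> = 2 ^ CARD('i) - 1"
    by (subst card_Diff_singleton) (auto simp: card_Pow)
  finally show ?thesis .
qed

definition subtuple :: "('i \<Rightarrow> 'w \<Rightarrow> 'b) \<Rightarrow> 'i set \<Rightarrow> 'w \<Rightarrow> 'i \<Rightarrow> 'b" where
  "subtuple X S \<omega> = restrict (\<lambda>i. X i \<omega>) S"

text \<open>
  Shannon entropies (in bits) of all non-empty subtuples. The expression below is what the
  abbreviation \<open>\<H>(subtuple X S)\<close> of the locale \<open>information_space\<close> stands for.
\<close>

definition entropy_profile :: "'w measure \<Rightarrow> ('i::finite \<Rightarrow> 'w \<Rightarrow> 'b) \<Rightarrow> real ^ 'i neset" where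
  "entropy_profile M X = (\<chi> S. let XS = subtuple X (Rep_neset S) in
     prob_space.entropy M 2 (count_space (XS ` space M)) XS)"

text \<open>
  Sample space and values are taken in \<open>nat\<close> because a definition cannot quantify over types;
  for random variables with finite range this loses no generality, see
  \<open>entropy_profile_in_entropic\<close> below.
\<close>

definition entropic :: "(real ^ 'i::finite neset) set" where
  "entropic = {entropy_profile M X | (M :: nat measure) (X :: 'i \<Rightarrow> nat \<Rightarrow> nat).
     prob_space M \<and> (\<forall>i. simple_function M (X i))}"

definition almost_entropic :: "(real ^ 'i::finite neset) set" where
  "almost_entropic = closure entropic"

lemma simple_function_subtuple:
  fixes X :: "'i::finite \<Rightarrow> 'w \<Rightarrow> 'b"
  assumes X: "\<And>i. simple_function M (X i)"
  shows "simple_function M (subtuple X S)"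
proof -
  have "subtuple X S ` space M \<subseteq> (\<Pi>\<^sub>E i\<in>S. X i ` space M)"
    by (auto simp: subtuple_def)
  moreover have "finite (\<Pi>\<^sub>E i\<in>S. X i ` space M)"
    by (intro finite_PiE) (auto intro: simple_functionD(1)[OF X])
  ultimately have fin: "finite (subtuple X S ` space M)"
    by (rule finite_subset)
  have "subtuple X S -` {x} \<inter> space M \<in> sets M" if "x \<in> subtuple X S ` space M" for x
  proof -
    have "x i = undefined" if "i \<notin> S" for i
      using \<open>x \<in> subtuple X S ` space M\<close> that by (auto simp: subtuple_def)
    then have "subtuple X S \<omega> = x \<longleftrightarrow> (\<forall>i\<in>S. X i \<omega> = x i)" for \<omega>
      unfolding subtuple_def fun_eq_iff restrict_def by metis
    then have "subtuple X S -` {x} \<inter> space M = {\<omega> \<in> space M. \<forall>i\<in>S. X i \<omega> \<in> {x i}}"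
      by auto
    also have "\<dots> \<in> sets M"
    proof (intro sets.sets_Collect_finite_All)
      fix i
      have "X i -` {x i} \<inter> space M \<in> sets M"
        by (rule simple_functionD(2)[OF X])
      also have "X i -` {x i} \<inter> space M = {\<omega> \<in> space M. X i \<omega> \<in> {x i}}"
        by auto
      finally show "{\<omega> \<in> space M. X i \<omega> \<in> {x i}} \<in> sets M" .
    qed simp
    finally show ?thesis .
  qed
  with fin show ?thesis
    by (auto simp: simple_function_def)
qed

lemma entropy_profile_in_entropic:
  fixes M :: "'w measure" and X :: "'i::finite \<Rightarrow> 'w \<Rightarrow> 'b"
  assumes "prob_space M" and X: "\<And>i. simple_function M (X i)"
  shows "entropy_profile M X \<in> entropic"
proof -
  interpret information_space M 2
    using assms(1) by (simp add: information_space_def information_space_axioms_def)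
  define T where "T = subtuple X UNIV"
  have T: "simple_function M T"
    unfolding T_def by (rule simple_function_subtuple[OF X])
  obtain g :: "('i \<Rightarrow> 'b) \<Rightarrow> nat" where g: "inj_on g (T ` space M)"
    using finite_imp_inj_to_nat_seg[OF simple_functionD(1)[OF T]] by blast
  have fin: "finite (\<Union>i. X i ` space M)"
    by (auto intro: simple_functionD(1)[OF X])
  obtain f :: "'b \<Rightarrow> nat" where f: "inj_on f (\<Union>i. X i ` space M)"
    using finite_imp_inj_to_nat_seg[OF fin] by blast
  define Z where "Z = g \<circ> T"
  define N where "N = distr M (count_space (Z ` space M)) Z"
  define Y where "Y i n = f (inv_into (T ` space M) g n i)" for i n
  have Z: "simple_function M Z"
    unfolding Z_def using T by (rule simple_function_compose)
  then have Zm: "Z \<in> measurable M (count_space (Z ` space M))"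
    by (auto simp: simple_function_def measurable_count_space_eq2)
  have spN: "space N = Z ` space M" and setsN: "sets N = Pow (Z ` space M)"
    by (auto simp: N_def)
  have N: "prob_space N"
    unfolding N_def by (rule prob_space_distr[OF Zm])
  have YZ: "Y i (Z \<omega>) = f (X i \<omega>)" if "\<omega> \<in> space M" for i \<omega>
    using that g by (simp add: Y_def Z_def T_def subtuple_def)
  have Y: "simple_function N (Y i)" for i
    using simple_functionD(1)[OF Z] by (auto simp: simple_function_def spN setsN)
  have "entropy_profile N Y $ S = entropy_profile M X $ S" for S
  proof -
    let ?S = "Rep_neset S"
    let ?X = "subtuple X ?S" and ?Y = "subtuple Y ?S"
    define h where "h x = restrict (\<lambda>i. f (x i)) ?S" for x :: "'i \<Rightarrow> 'b"
    have YX: "?Y (Z \<omega>) = h (?X \<omega>)" if "\<omega> \<in> space M" for \<omega>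
      using that by (auto simp: subtuple_def h_def YZ)
    have img: "?Y ` space N = (h \<circ> ?X) ` space M"
      using YX by (force simp: spN)
    have "inj_on h (?X ` space M)"
    proof (rule inj_onI)
      fix x y assume xy: "x \<in> ?X ` space M" "y \<in> ?X ` space M" "h x = h y"
      have "x i = y i" for i
      proof (cases "i \<in> ?S")
        case True
        then have "f (x i) = f (y i)"
          using fun_cong[OF xy(3), of i] by (simp add: h_def)
        moreover have "x i \<in> X i ` space M" "y i \<in> X i ` space M"
          using xy True by (auto simp: subtuple_def)
        ultimately show ?thesis
          using f by (auto dest: inj_onD)
      qed (use xy in \<open>auto simp: subtuple_def\<close>)
      then show "x = y"
        by (rule ext)
    qed
    then have inj: "prob_space.entropy M 2 (count_space ((h \<circ> ?X) ` space M)) (h \<circ> ?X)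
      = prob_space.entropy M 2 (count_space (?X ` space M)) ?X"
      by (intro entropy_of_inj simple_function_subtuple X)
    have "distr N (count_space (?Y ` space N)) ?Y
      = distr M (count_space (?Y ` space N)) (?Y \<circ> Z)"
      unfolding N_def by (rule distr_distr) (use Zm in \<open>auto simp: N_def\<close>)
    also have "\<dots> = distr M (count_space ((h \<circ> ?X) ` space M)) (h \<circ> ?X)"
      unfolding img by (rule distr_cong) (auto simp: YX)
    finally have "prob_space.entropy N 2 (count_space (?Y ` space N)) ?Y
      = prob_space.entropy M 2 (count_space ((h \<circ> ?X) ` space M)) (h \<circ> ?X)"
      unfolding prob_space.entropy_def[OF N] entropy_def img by simp
    with inj show ?thesis
      by (simp add: entropy_profile_def Let_def)
  qed
  then have "entropy_profile M X = entropy_profile N Y"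
    by (simp add: vec_eq_iff)
  then show ?thesis
    unfolding entropic_def by (intro CollectI exI conjI allI) (auto intro: N Y)
qed

text \<open>
  Linear combinations of the coordinates of an arbitrary point. A pair of tuples is the union of
  the corresponding sets of variables; all arguments are meant to be non-empty.
\<close>

definition entr :: "real ^ 'i::finite neset \<Rightarrow> 'i set \<Rightarrow> real" where
  "entr h S = h $ Abs_neset S"

definition cond_entr :: "real ^ 'i::finite neset \<Rightarrow> 'i set \<Rightarrow> 'i set \<Rightarrow> real" where
  "cond_entr h X Y = entr h (X \<union> Y) - entr h Y"

definition mut_inf :: "real ^ 'i::finite neset \<Rightarrow> 'i set \<Rightarrow> 'i set \<Rightarrow> real" where
  "mut_inf h X Y = entr h X + entr h Y - entr h (X \<union> Y)"

definition cond_mut_inf :: "real ^ 'i::finite neset \<Rightarrow> 'i set \<Rightarrow> 'i set \<Rightarrow> 'i set \<Rightarrow> real" where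
  "cond_mut_inf h X Y Z =
     entr h (X \<union> Z) + entr h (Y \<union> Z) - entr h (X \<union> Y \<union> Z) - entr h Z"

definition ingleton_box ::
  "real ^ 'i::finite neset \<Rightarrow> 'i set \<Rightarrow> 'i set \<Rightarrow> 'i set \<Rightarrow> 'i set \<Rightarrow> real" where
  "ingleton_box h X Y Z W =
     cond_mut_inf h Z W X + cond_mut_inf h Z W Y + mut_inf h X Y - mut_inf h Z W"

datatype rvar = A | B | C | D

lemma UNIV_rvar: "UNIV = {A, B, C, D}"
  using rvar.exhaust by auto

instance rvar :: finite
  by standard (simp add: UNIV_rvar)

lemma card_neset_rvar: "CARD(rvar neset) = 15"
  by (simp add: card_neset UNIV_rvar)

end

theory Submission
  imports Defs "HOL-Real_Asymp.Real_Asymp" "HOL-Library.Function_Algebras" "Berlekamp_Zassenhaus.Finite_Field"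
begin

text \<open>
  Over a finite field with \<open>q\<close> elements, let \<open>C\<close> be a random non-vertical line, \<open>A\<close> and \<open>B\<close> two
  independent random points of \<open>C\<close>, and \<open>D\<close> a random parabola through \<open>A\<close> and \<open>B\<close> (tangent to
  \<open>C\<close> if \<open>A = B\<close>). Then \<open>I(A:B|C) = 0\<close>, the quantities \<open>I(A:B)\<close> and \<open>H(C|A,B)\<close> are both equal to
  \<open>log q / q\<close>, and the Ingleton expression is \<open>log q / q - (1 - 1 / q)\<close>, because \<open>C\<close> and \<open>D\<close>
  determine only the unordered pair of \<open>A\<close> and \<open>B\<close>.

  To make one of the two small quantities negligible, take \<open>n\<close> independent copies and use a random
  matrix over the field, with \<open>n = 3 m\<close> and \<open>q = 5\<close>. For \<open>H(C|A,B)\<close>, confine the vector of slopes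
  to the kernel of an \<open>m\<close> by \<open>n\<close> matrix: \<open>A\<close> and \<open>B\<close> leave the slope unknown only where their
  abscissae agree, in about \<open>n / q < m\<close> coordinates, and the linear constraints recover it. For
  \<open>I(A:B)\<close>, replace the ordinates of \<open>A\<close> by their image under an \<open>n - m\<close> by \<open>n\<close> matrix: given \<open>B\<close>
  the ordinates are uniform outside those coordinates, hence their image is nearly uniform. In both
  cases the Ingleton expression is at most \<open>m log q - n (1 - 1 / q)\<close> up to negligible terms, which is
  negative since \<open>log 5 / 3 < 1 - 1 / 5\<close>. Dividing by \<open>n\<close> and passing to a convergent subsequence
  gives the points.
\<close>

section \<open>Entropies of uniform distributions\<close>

definition fibre :: "'w set \<Rightarrow> ('i \<Rightarrow> 'w \<Rightarrow> 'b) \<Rightarrow> 'i set \<Rightarrow> 'w \<Rightarrow> 'w set" where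
  "fibre W X S w = {w' \<in> W. \<forall>i\<in>S. X i w' = X i w}"

text \<open>Under the uniform distribution on \<open>W\<close>, the value taken at \<open>w\<close>
  has probability \<open>card (fibre W X S w) / card W\<close>. Averaging minus its logarithm over
  sample points, rather than over values, turns entropy into counting.\<close>

definition uniform_entropy :: "'w set \<Rightarrow> ('i \<Rightarrow> 'w \<Rightarrow> 'b) \<Rightarrow> 'i set \<Rightarrow> real" where
  "uniform_entropy W X S =
     log 2 (card W) - (\<Sum>w\<in>W. log 2 (card (fibre W X S w))) / card W"

lemma fibre_subset: "fibre W X S w \<subseteq> W"
  by (auto simp: fibre_def)

lemma card_fibre_pos:
  assumes "finite W" "w \<in> W"
  shows "0 < card (fibre W X S w)"
proof -
  have "w \<in> fibre W X S w" using assms by (simp add: fibre_def)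
  then show ?thesis using finite_subset[OF fibre_subset assms(1)] card_gt_0_iff by blast
qed

lemma log2_of_nat_mono: "0 < j \<Longrightarrow> j \<le> k \<Longrightarrow> log 2 (real j) \<le> log 2 (real k)"
  by simp

lemma log2_card_fibre_nonneg:
  assumes "finite W" "w \<in> W"
  shows "0 \<le> log 2 (card (fibre W X S w))"
  using card_fibre_pos[OF assms, of X S] by (simp add: Suc_leI)

lemma uniform_entropy_nonneg:
  assumes "finite W" "W \<noteq> {}"
  shows "0 \<le> uniform_entropy W X S"
proof -
  have "(\<Sum>w\<in>W. log 2 (card (fibre W X S w))) \<le> card W * log 2 (card W)"
    using assms
    by (intro sum_bounded_above log2_of_nat_mono card_fibre_pos card_mono fibre_subset)
  then show ?thesis
    using assms
    by (simp add: uniform_entropy_def divide_simps card_gt_0_iff right_diff_distrib mult.commute)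
qed

lemma uniform_entropy_le:
  assumes "finite W" "W \<noteq> {}"
  shows "uniform_entropy W X S \<le> log 2 (card W)"
proof -
  have "0 \<le> (\<Sum>w\<in>W. log 2 (card (fibre W X S w)))"
    using assms(1) by (intro sum_nonneg log2_card_fibre_nonneg)
  then show ?thesis by (simp add: uniform_entropy_def)
qed

lemma uniform_entropy_const:
  assumes "finite W" "W \<noteq> {}" "\<And>w. w \<in> W \<Longrightarrow> card (fibre W X S w) = k"
  shows "uniform_entropy W X S = log 2 (card W) - log 2 k"
  using assms by (simp add: uniform_entropy_def)

lemma uniform_entropy_le_const:
  assumes "finite W" "W \<noteq> {}" "0 < k" "\<And>w. w \<in> W \<Longrightarrow> k \<le> card (fibre W X S w)"
  shows "uniform_entropy W X S \<le> log 2 (card W) - log 2 k"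
proof -
  have "card W * log 2 k \<le> (\<Sum>w\<in>W. log 2 (card (fibre W X S w)))"
    using assms by (intro sum_bounded_below log2_of_nat_mono)
  then show ?thesis
    using assms
    by (simp add: uniform_entropy_def divide_simps card_gt_0_iff right_diff_distrib mult.commute)
qed

lemma uniform_entropy_ge_const:
  assumes "finite W" "W \<noteq> {}" "\<And>w. w \<in> W \<Longrightarrow> card (fibre W X S w) \<le> k"
  shows "log 2 (card W) - log 2 k \<le> uniform_entropy W X S"
proof -
  have "(\<Sum>w\<in>W. log 2 (card (fibre W X S w))) \<le> card W * log 2 k"
    using assms by (intro sum_bounded_above log2_of_nat_mono card_fibre_pos)
  then show ?thesis
    using assms
    by (simp add: uniform_entropy_def divide_simps card_gt_0_iff right_diff_distrib mult.commute)
qed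

lemma subtuple_eq_iff: "subtuple X S w' = subtuple X S w \<longleftrightarrow> (\<forall>i\<in>S. X i w' = X i w)"
  by (auto simp: subtuple_def restrict_def fun_eq_iff)

lemma entropy_profile_uniform:
  fixes X :: "'i::finite \<Rightarrow> 'w \<Rightarrow> 'b"
  assumes W: "finite W" "W \<noteq> {}" and S: "S \<noteq> {}"
  shows "entr (entropy_profile (uniform_count_measure W) X) S = uniform_entropy W X S"
proof -
  let ?M = "uniform_count_measure W"
  interpret prob_space ?M using W by (rule prob_space_uniform_count_measure)
  interpret information_space ?M 2
    by standard simp
  let ?Y = "subtuple X S"
  define p where "p x = card {w \<in> W. ?Y w = x} / card W" for x
  have sp: "space ?M = W" by (simp add: space_uniform_count_measure)
  have sf: "simple_function ?M ?Y"
    using W by (auto simp: simple_function_def space_uniform_count_measure sets_uniform_count_measure)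
  have m: "p x = measure ?M (?Y -` {x} \<inter> space ?M)" for x
  proof -
    have *: "?Y -` {x} \<inter> space ?M = {w \<in> W. ?Y w = x}" by (auto simp: sp)
    show ?thesis unfolding * p_def using W by (subst measure_uniform_count_measure) auto
  qed
  have "simple_distributed ?M ?Y p"
    using sf by (rule simple_distributedI) (use m in \<open>auto simp: p_def\<close>)
  from entropy_simple_distributed[OF this]
  have "entropy 2 (count_space (?Y ` W)) ?Y = - (\<Sum>x\<in>?Y ` W. p x * log 2 (p x))"
    unfolding sp .
  \<comment> \<open>Pass from values to sample points: the value \<open>x\<close> is taken at
    \<open>p x * card W\<close> of them.\<close>
  also have "(\<Sum>x\<in>?Y ` W. p x * log 2 (p x)) = (\<Sum>w\<in>W. log 2 (p (?Y w)) / card W)"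
  proof -
    have "(\<Sum>w\<in>W. log 2 (p (?Y w)) / card W)
      = (\<Sum>x\<in>?Y ` W. \<Sum>w | w \<in> W \<and> ?Y w = x. log 2 (p (?Y w)) / card W)"
      using W(1) by (rule sum.image_gen)
    also have "\<dots> = (\<Sum>x\<in>?Y ` W. p x * log 2 (p x))"
      by (intro sum.cong refl) (simp add: p_def)
    finally show ?thesis by simp
  qed
  also have "\<dots> = (\<Sum>w\<in>W. (log 2 (card (fibre W X S w)) - log 2 (card W)) / card W)"
  proof (intro sum.cong refl)
    fix w assume w: "w \<in> W"
    have "{w' \<in> W. ?Y w' = ?Y w} = fibre W X S w"
      by (simp add: fibre_def subtuple_eq_iff)
    then have "p (?Y w) = card (fibre W X S w) / card W" by (simp add: p_def)
    moreover have "0 < card W" "0 < card (fibre W X S w)"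
      using W card_fibre_pos[OF W(1) w] by (auto simp: card_gt_0_iff)
    ultimately show "log 2 (p (?Y w)) / card W
        = (log 2 (card (fibre W X S w)) - log 2 (card W)) / card W"
      by (simp add: log_divide)
  qed
  also have "\<dots> = (\<Sum>w\<in>W. log 2 (card (fibre W X S w))) / card W - log 2 (card W)"
    using W by (simp add: sum_divide_distrib[symmetric] sum_subtractf diff_divide_distrib)
  finally have "entropy 2 (count_space (?Y ` W)) ?Y = uniform_entropy W X S" by (simp add: uniform_entropy_def)
  then show ?thesis
    using S by (simp add: entr_def entropy_profile_def Let_def Abs_neset_inverse sp)
qed

text \<open>Sampling \<open>X\<close> only with probability \<open>1 / n\<close>, and outputting a distinguished constant
  otherwise, divides all entropies by \<open>n\<close> up to a common additive defect that vanishes as \<open>n\<close> grows.\<close>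

definition time_sharing_defect :: "nat \<Rightarrow> real" where
  "time_sharing_defect n = log 2 n - (1 - 1 / n) * log 2 (real n - 1)"

lemma scaled_uniform_entropy_entropic:
  fixes X :: "'i::finite \<Rightarrow> 'w \<Rightarrow> 'b"
  assumes W: "finite W" "W \<noteq> {}" and n: "2 \<le> n"
  shows "\<exists>h \<in> entropic. \<forall>S. S \<noteq> {} \<longrightarrow>
    entr h S = uniform_entropy W X S / n + time_sharing_defect n"
proof -
  \<comment> \<open>The extra index is uniform on \<open>{..<n}\<close>, and \<open>X\<close> is
    revealed only at index 0. All variables turn into \<open>None\<close> together, so every
    non-empty subtuple shows whether the index is 0; hence the defect does not depend on
    \<open>S\<close>.\<close>
  define W' where "W' = W \<times> {..<n}"
  define X' where "X' i w = (if snd w = 0 then Some (X i (fst w)) else None)"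
    for i and w :: "'w \<times> nat"
  have "(0::nat) \<in> {..<n}" using n by simp
  then have W': "finite W'" "W' \<noteq> {}" using W unfolding W'_def by blast+
  have cW: "card W \<noteq> 0" using W by simp
  have cW': "card W' = card W * n" by (simp add: W'_def card_cartesian_product)
  have "entropy_profile (uniform_count_measure W') X' \<in> entropic"
    using W'
    by (intro entropy_profile_in_entropic prob_space_uniform_count_measure)
       (auto simp: simple_function_def space_uniform_count_measure sets_uniform_count_measure)
  moreover have "entr (entropy_profile (uniform_count_measure W') X') S
      = uniform_entropy W X S / n + time_sharing_defect n" if S: "S \<noteq> {}" for S
  proof -
    have f0: "card (fibre W' X' S (w, 0)) = card (fibre W X S w)" for w
    proof -
      have "fibre W' X' S (w, 0) = fibre W X S w \<times> {0}"
        using S n by (auto simp: fibre_def W'_def X'_def split: if_splits)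
      then show ?thesis by (simp add: card_cartesian_product)
    qed
    have f1: "card (fibre W' X' S (w, j)) = card W * (n - 1)" if "j \<noteq> 0" for w j
    proof -
      have "fibre W' X' S (w, j) = W \<times> {1..<n}"
        using S n that by (auto simp: fibre_def W'_def X'_def split: if_splits)
      then show ?thesis by (simp add: card_cartesian_product)
    qed
    have "(\<Sum>w\<in>W'. log 2 (card (fibre W' X' S w)))
      = (\<Sum>w\<in>W. \<Sum>j<n. log 2 (card (fibre W' X' S (w, j))))"
      unfolding W'_def by (simp add: sum.cartesian_product)
    also have "\<dots> = (\<Sum>w\<in>W. log 2 (card (fibre W X S w)) + (real n - 1) * log 2 (card W * (n - 1)))"
    proof (intro sum.cong refl)
      fix w
      have "{..<n} = insert 0 {1..<n}" using n by auto
      then show "(\<Sum>j<n. log 2 (card (fibre W' X' S (w, j))))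
         = log 2 (card (fibre W X S w)) + (real n - 1) * log 2 (card W * (n - 1))"
        using n by (simp add: f0 f1 of_nat_diff)
    qed
    also have "\<dots> = (\<Sum>w\<in>W. log 2 (card (fibre W X S w)))
        + card W * (real n - 1) * (log 2 (card W) + log 2 (real n - 1))"
      using n cW by (simp add: sum.distrib log_mult of_nat_diff)
    finally have "uniform_entropy W' X' S = log 2 (card W) + log 2 n
      - ((\<Sum>w\<in>W. log 2 (card (fibre W X S w)))
        + card W * (real n - 1) * (log 2 (card W) + log 2 (real n - 1))) / (card W * n)"
      unfolding uniform_entropy_def cW' using cW n by (simp add: log_mult)
    also have "\<dots> = uniform_entropy W X S / n + time_sharing_defect n"
      using cW n by (simp add: uniform_entropy_def time_sharing_defect_def field_simps)
    finally show ?thesis using W' S by (simp add: entropy_profile_uniform)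
  qed
  ultimately show ?thesis by blast
qed

text \<open>The defect is the binary entropy of \<open>1 / n\<close>.\<close>

lemma time_sharing_defect_tendsto: "time_sharing_defect \<longlonglongrightarrow> 0"
  unfolding time_sharing_defect_def log_def by real_asymp

text \<open>The scaled profiles stay in a bounded part of a finite-dimensional space, so
  Bolzano-Weierstrass yields a limit point; the defect disappears in the limit.\<close>

lemma almost_entropic_limit:
  fixes X :: "nat \<Rightarrow> 'i::finite \<Rightarrow> 'w \<Rightarrow> 'b"
  assumes W: "\<And>m. finite (W m)" "\<And>m. W m \<noteq> {}"
    and bound: "\<And>m. log 2 (card (W m)) \<le> c * real (n m)"
    and n: "filterlim n at_top sequentially" "\<And>m. 2 \<le> n m"
  shows "\<exists>h \<in> almost_entropic. \<exists>r. strict_mono r \<and> (\<forall>S. S \<noteq> {} \<longrightarrow>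
    (\<lambda>m. uniform_entropy (W (r m)) (X (r m)) S / n (r m)) \<longlonglongrightarrow> entr h S)"
proof -
  have "\<exists>h. h \<in> entropic \<and> (\<forall>S. S \<noteq> {} \<longrightarrow>
    entr h S = uniform_entropy (W m) (X m) S / n m + time_sharing_defect (n m))" for m
    using scaled_uniform_entropy_entropic[OF W n(2)] by (simp add: Bex_def)
  then obtain h where h: "\<And>m. h m \<in> entropic" and hS: "\<And>m S. S \<noteq> {} \<Longrightarrow>
      entr (h m) S = uniform_entropy (W m) (X m) S / n m + time_sharing_defect (n m)"
    by metis
  have lim0: "(\<lambda>m. time_sharing_defect (n m)) \<longlonglongrightarrow> 0"
    using time_sharing_defect_tendsto n(1) by (rule filterlim_compose)
  obtain b where b: "\<And>m. norm (time_sharing_defect (n m)) \<le> b"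
    using convergent_imp_Bseq[OF convergentI[OF lim0]] by (auto simp: Bseq_def)
  have "\<bar>h m $ s\<bar> \<le> c + b" for m s
  proof -
    let ?S = "Rep_neset s"
    have S: "?S \<noteq> {}" using Rep_neset[of s] by simp
    have "uniform_entropy (W m) (X m) ?S / n m \<le> c"
      using order_trans[OF uniform_entropy_le[OF W] bound] n(2)[of m]
      by (simp add: divide_simps)
    moreover have "0 \<le> uniform_entropy (W m) (X m) ?S / n m"
      using W by (simp add: uniform_entropy_nonneg)
    moreover have "h m $ s = entr (h m) ?S" by (simp add: entr_def Rep_neset_inverse)
    ultimately show ?thesis using hS[OF S, of m] b[of m] by simp
  qed
  then have "norm (h m) \<le> (\<Sum>s\<in>(UNIV :: 'i neset set). c + b)" for m
    by (intro order_trans[OF norm_le_l1_cart] sum_mono)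
  then have "bounded (range h)"
    by (auto simp: bounded_iff)
  then obtain l r where r: "strict_mono r" and l: "(h \<circ> r) \<longlonglongrightarrow> l"
    using bounded_imp_convergent_subsequence by blast
  have "l \<in> almost_entropic"
    unfolding almost_entropic_def closure_sequential using l h
    by (intro exI[of _ "h \<circ> r"]) auto
  moreover have "(\<lambda>m. uniform_entropy (W (r m)) (X (r m)) S / n (r m)) \<longlonglongrightarrow> entr l S"
    if "S \<noteq> {}" for S
  proof -
    have "(\<lambda>m. entr (h (r m)) S) \<longlonglongrightarrow> entr l S"
      unfolding entr_def using tendsto_vec_nth[OF l] by (simp add: o_def)
    moreover have "(\<lambda>m. time_sharing_defect (n (r m))) \<longlonglongrightarrow> 0"
      using LIMSEQ_subseq_LIMSEQ[OF lim0 r] by (simp add: o_def)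
    ultimately have "(\<lambda>m. entr (h (r m)) S - time_sharing_defect (n (r m))) \<longlonglongrightarrow> entr l S - 0"
      by (rule tendsto_diff)
    then show ?thesis by (simp add: hS[OF that])
  qed
  ultimately show ?thesis using r by blast
qed

section \<open>Random matrices over a finite field\<close>

text \<open>A non-empty set closed under differences is a subgroup, and all non-empty fibres of a
  homomorphism on it are translates of the kernel.\<close>

lemma card_eq_image_times_kernel:
  fixes f :: "'b::ab_group_add \<Rightarrow> 'c::ab_group_add"
  assumes fin: "finite V" and diff: "\<And>x y. x \<in> V \<Longrightarrow> y \<in> V \<Longrightarrow> x - y \<in> V"
    and f: "\<And>x y. x \<in> V \<Longrightarrow> y \<in> V \<Longrightarrow> f (x - y) = f x - f y"
  shows "card V = card (f ` V) * card {x \<in> V. f x = 0}"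
proof -
  have "card {x \<in> V. f x = f v} = card {x \<in> V. f x = 0}" if v: "v \<in> V" for v
  proof (rule bij_betw_same_card[of "\<lambda>x. x - v"], rule bij_betw_byWitness[of _ "\<lambda>x. x + v"])
    have "0 \<in> V" using diff[OF v v] by simp
    then have "- v \<in> V" using diff[of 0 v] v by simp
    then have add: "x + v \<in> V" if "x \<in> V" for x using diff[OF that \<open>- v \<in> V\<close>] by simp
    have "f (x + v) = f x + f v" if "x \<in> V" for x
      using f[OF add[OF that] v] by (simp add: algebra_simps)
    then show "(\<lambda>x. x + v) ` {x \<in> V. f x = 0} \<subseteq> {x \<in> V. f x = f v}"
      using add by auto
    show "(\<lambda>x. x - v) ` {x \<in> V. f x = f v} \<subseteq> {x \<in> V. f x = 0}"
      using v by (auto simp: diff f)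
  qed auto
  then have "(\<Sum>y\<in>f ` V. card {x \<in> V. f x = y}) = (\<Sum>y\<in>f ` V. card {x \<in> V. f x = 0})"
    by (intro sum.cong) auto
  moreover have "card V = (\<Sum>y\<in>f ` V. card {x \<in> V. f x = y})"
    using sum.image_gen[OF fin, of "\<lambda>_. 1::nat" f] by simp
  ultimately show ?thesis by simp
qed

text \<open>Expectations of products over independent coordinates factorise; stated for functions
  with default \<open>d\<close> outside \<open>I\<close>, the form in which vectors are
  encoded.\<close>

lemma sum_PiE_dflt_prod:
  fixes f :: "'i \<Rightarrow> 'b \<Rightarrow> 'c::comm_semiring_1"
  assumes "finite I" "\<And>i. i \<in> I \<Longrightarrow> finite (S i)"
  shows "(\<Sum>v\<in>PiE_dflt I d S. \<Prod>i\<in>I. f i (v i)) = (\<Prod>i\<in>I. \<Sum>x\<in>S i. f i x)"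
proof -
  have "inj_on (\<lambda>h x. if x \<in> I then h x else d) (PiE I S)"
  proof (rule inj_onI)
    fix g h
    assume "g \<in> PiE I S" "h \<in> PiE I S"
      "(\<lambda>x. if x \<in> I then g x else d) = (\<lambda>x. if x \<in> I then h x else d)"
    then show "g = h" by (intro PiE_ext[of g I S h]) (auto dest: fun_cong split: if_splits)
  qed
  then have "(\<Sum>v\<in>PiE_dflt I d S. \<Prod>i\<in>I. f i (v i)) = (\<Sum>v\<in>PiE I S. \<Prod>i\<in>I. f i (v i))"
    by (simp add: dflt_image_PiE[symmetric] sum.reindex)
  then show ?thesis using assms by (simp add: prod_sum_PiE)
qed

text \<open>Vectors of length \<open>n\<close> are functions vanishing outside \<open>{..<n}\<close>, so that the pointwise
  ring operations on functions apply to them.\<close>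

definition vecs :: "nat \<Rightarrow> (nat \<Rightarrow> 'a::zero) set" where
  "vecs n = PiE_dflt {..<n} 0 (\<lambda>_. UNIV)"

lemma vecs_iff: "v \<in> vecs n \<longleftrightarrow> (\<forall>i\<ge>n. v i = 0)"
  by (auto simp: vecs_def PiE_dflt_def not_less)

lemma finite_vecs [simp]: "finite (vecs n :: (nat \<Rightarrow> 'a::{zero,finite}) set)"
  by (auto simp: vecs_def)

lemma vecs_nonempty [simp]: "vecs n \<noteq> {}"
  by (simp add: vecs_def)

lemma card_vecs: "card (vecs n :: (nat \<Rightarrow> 'a::{zero,finite}) set) = CARD('a) ^ n"
  by (simp add: vecs_def card_PiE_dflt)

lemma vecs_closed [simp]:
  fixes u v w :: "nat \<Rightarrow> 'a::ring"
  shows "0 \<in> vecs n" "u \<in> vecs n \<Longrightarrow> v \<in> vecs n \<Longrightarrow> u + v \<in> vecs n"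
    "u \<in> vecs n \<Longrightarrow> v \<in> vecs n \<Longrightarrow> u - v \<in> vecs n"
    "u \<in> vecs n \<Longrightarrow> u * w \<in> vecs n" "u \<in> vecs n \<Longrightarrow> w * u \<in> vecs n"
  by (simp_all add: vecs_iff)

definition mats :: "nat \<Rightarrow> nat \<Rightarrow> (nat \<Rightarrow> nat \<Rightarrow> 'a::zero) set" where
  "mats k n = PiE_dflt {..<k} (\<lambda>_. 0) (\<lambda>_. vecs n)"

definition matvec :: "nat \<Rightarrow> nat \<Rightarrow> (nat \<Rightarrow> nat \<Rightarrow> 'a::comm_ring_1) \<Rightarrow> (nat \<Rightarrow> 'a) \<Rightarrow> nat \<Rightarrow> 'a" where
  "matvec k n M v = (\<lambda>i. if i < k then \<Sum>j<n. M i j * v j else 0)"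

lemma matvec_in_vecs [simp]: "matvec k n M v \<in> vecs k"
  by (simp add: matvec_def vecs_iff)

lemma matvec_diff: "matvec k n M (u - v) = matvec k n M u - matvec k n M v"
  by (simp add: matvec_def fun_eq_iff algebra_simps sum_subtractf)

lemma matvec_0 [simp]: "matvec k n M 0 = 0"
  by (simp add: matvec_def fun_eq_iff)

lemma finite_mats [simp]: "finite (mats k n :: (nat \<Rightarrow> nat \<Rightarrow> 'a::{zero,finite}) set)"
  by (auto simp: mats_def)

lemma mats_nonempty: "mats k n \<noteq> {}"
  by (auto simp: mats_def vecs_def)

text \<open>A non-zero linear functional is onto the field, so its kernel has index
  \<open>CARD('a)\<close>.\<close>

lemma card_hyperplane:
  fixes v :: "nat \<Rightarrow> 'a::{field,finite}"
  assumes "v \<in> vecs n" "v \<noteq> 0"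
  shows "card {r \<in> vecs n. (\<Sum>j<n. r j * v j) = 0} * CARD('a) = CARD('a) ^ n"
proof -
  let ?f = "\<lambda>r. \<Sum>j<n. r j * v j"
  obtain i where i: "v i \<noteq> 0" using assms(2) by (auto simp: fun_eq_iff)
  then have "i < n" using assms(1) by (meson not_less vecs_iff)
  have "t \<in> ?f ` vecs n" for t
  proof
    \<comment> \<open>A vector supported on one coordinate where \<open>v\<close> does not vanish
      already reaches the value \<open>t\<close>.\<close>
    let ?r = "\<lambda>j. if j = i then t / v i else 0"
    show "?r \<in> vecs n" using \<open>i < n\<close> by (simp add: vecs_iff)
    have "?f ?r = (\<Sum>j<n. if j = i then t else 0)"
      using i by (intro sum.cong) auto
    then show "t = ?f ?r" using \<open>i < n\<close> by simp
  qed
  then have "?f ` vecs n = UNIV" by blast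
  moreover have "card (vecs n :: (nat \<Rightarrow> 'a) set) = card (?f ` vecs n) * card {r \<in> vecs n. ?f r = 0}"
    by (rule card_eq_image_times_kernel) (auto simp: algebra_simps sum_subtractf)
  ultimately show ?thesis by (simp add: card_vecs mult.commute)
qed

text \<open>The rows of a random matrix are independent, and each annihilates \<open>v\<close> with
  probability \<open>1 / CARD('a)\<close>.\<close>

lemma card_mats_kernel:
  fixes v :: "nat \<Rightarrow> 'a::{field,finite}"
  assumes "v \<in> vecs n" "v \<noteq> 0"
  shows "card {M \<in> mats k n. matvec k n M v = 0} * CARD('a) ^ k
    = card (mats k n :: (nat \<Rightarrow> nat \<Rightarrow> 'a) set)"
proof -
  have "{M \<in> mats k n. matvec k n M v = 0}
     = PiE_dflt {..<k} (\<lambda>_. 0) (\<lambda>_. {r \<in> vecs n. (\<Sum>j<n. r j * v j) = 0})"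
    by (auto simp: mats_def PiE_dflt_def matvec_def fun_eq_iff)
  then have "card {M \<in> mats k n. matvec k n M v = 0}
      = card {r \<in> vecs n. (\<Sum>j<n. r j * v j) = 0} ^ k"
    by (simp add: card_PiE_dflt)
  then have "card {M \<in> mats k n. matvec k n M v = 0} * CARD('a) ^ k = (CARD('a) ^ n) ^ k"
    by (simp add: card_hyperplane[OF assms] flip: power_mult_distrib)
  then show ?thesis by (simp add: mats_def card_PiE_dflt card_vecs)
qed

section \<open>Coordinates in which two vectors agree\<close>

definition agree :: "nat \<Rightarrow> (nat \<Rightarrow> 'a) \<Rightarrow> (nat \<Rightarrow> 'a) \<Rightarrow> nat" where
  "agree n a b = card {i. i < n \<and> a i = b i}"

lemma prod_agree: "(\<Prod>i<n. if a i = b i then c else 1) = c ^ agree n a b"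
proof -
  have "{..<n} \<inter> {i. a i = b i} = {i. i < n \<and> a i = b i}" by auto
  then show ?thesis by (simp add: prod.If_cases agree_def)
qed

lemma agree_le: "agree n a b \<le> n"
  using card_mono[of "{..<n}" "{i. i < n \<and> a i = b i}"] by (auto simp: agree_def)

text \<open>The sum factorises over coordinates: one value of \<open>b i\<close> contributes 2 and
  each of the others 1.\<close>

lemma sum_two_power_agree:
  fixes a :: "nat \<Rightarrow> 'a::{zero,finite}"
  shows "(\<Sum>b\<in>vecs n. (2::real) ^ agree n a b) = (real CARD('a) + 1) ^ n"
proof -
  have "(\<Sum>b\<in>vecs n. (2::real) ^ agree n a b)
    = (\<Sum>b\<in>vecs n. \<Prod>i<n. if a i = b i then 2 else 1)"
    by (simp add: prod_agree)
  also have "\<dots> = (\<Prod>i<n. \<Sum>x\<in>UNIV. if a i = x then 2 else 1)"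
    unfolding vecs_def by (rule sum_PiE_dflt_prod) auto
  also have "\<dots> = (\<Prod>i<n. real CARD('a) + 1)"
  proof (rule prod.cong)
    fix i
    have "(\<Sum>x\<in>UNIV. if a i = x then 2 else (1::real)) = (\<Sum>x\<in>UNIV. 1 + (if a i = x then 1 else 0))"
      by (intro sum.cong) auto
    then show "(\<Sum>x\<in>UNIV. if a i = x then 2 else 1) = real CARD('a) + 1"
      by (simp add: sum.distrib)
  qed simp
  finally show ?thesis by simp
qed

text \<open>By linearity of expectation, since a uniform \<open>b\<close> differs from
  \<open>a\<close> in a given coordinate with probability \<open>1 - 1 / CARD('a)\<close>.\<close>

lemma sum_disagree:
  fixes a :: "nat \<Rightarrow> 'a::{zero,finite}"
  shows "(\<Sum>b\<in>vecs n. real (n - agree n a b)) = n * (1 - 1 / CARD('a)) * CARD('a) ^ n"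
proof -
  have 1: "real (n - agree n a b) = (\<Sum>i<n. if a i = b i then 0 else 1)" for b :: "nat \<Rightarrow> 'a"
  proof -
    have "{..<n} \<inter> {i. a i = b i} = {i. i < n \<and> a i = b i}" by auto
    then have "(\<Sum>i<n. if a i = b i then 1 else 0) = real (agree n a b)"
      by (simp add: sum.If_cases agree_def)
    moreover have "(\<Sum>i<n. if a i = b i then 0 else 1)
        = (\<Sum>i<n. 1 - (if a i = b i then 1 else (0::real)))"
      by (intro sum.cong) auto
    ultimately show ?thesis by (simp add: sum_subtractf of_nat_diff agree_le)
  qed
  have 2: "(\<Sum>b\<in>vecs n. if a i = b i then 0 else (1::real)) = (1 - 1 / CARD('a)) * CARD('a) ^ n"
    if i: "i < n" for i
  proof -
    \<comment> \<open>The indicator of one coordinate is written as a product whose other factors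
      are 1, so that \<open>sum_PiE_dflt_prod\<close> applies.\<close>
    have "(\<Sum>b\<in>vecs n. if a i = b i then 0 else (1::real))
       = (\<Sum>b\<in>vecs n. \<Prod>j<n. if j = i then if a i = b j then 0 else 1 else 1)"
      using i by simp
    also have "\<dots> = (\<Prod>j<n. \<Sum>x\<in>UNIV. if j = i then if a i = x then 0 else 1 else 1)"
      unfolding vecs_def by (rule sum_PiE_dflt_prod) auto
    also have "\<dots> = (\<Sum>x\<in>UNIV. if a i = x then 0 else 1) * real CARD('a) ^ (n - 1)"
      using i by (subst prod.remove[of _ i]) auto
    also have "(\<Sum>x\<in>UNIV. if a i = x then 0 else (1::real)) = (\<Sum>x\<in>UNIV. 1 - (if a i = x then 1 else 0))"
      by (intro sum.cong) auto
    also have "\<dots> = real CARD('a) - 1" by (simp add: sum_subtractf)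
    also have "(real CARD('a) - 1) * real CARD('a) ^ (n - 1) = (1 - 1 / CARD('a)) * CARD('a) ^ n"
      using i by (cases n) (auto simp: field_simps)
    finally show ?thesis .
  qed
  have "(\<Sum>b\<in>vecs n. real (n - agree n a b))
    = (\<Sum>i<n. \<Sum>b\<in>vecs n. if a i = b i then 0 else (1::real))"
    unfolding 1 by (rule sum.swap)
  also have "\<dots> = (\<Sum>i<n. (1 - 1 / CARD('a)) * CARD('a) ^ n)"
    by (intro sum.cong refl 2) simp
  finally show ?thesis by simp
qed

text \<open>A field has no zero divisors, so \<open>u\<close> is free where \<open>a\<close> and
  \<open>b\<close> agree and zero elsewhere.\<close>

lemma card_supported_on_agreement:
  fixes a b :: "nat \<Rightarrow> 'a::{field,finite}"
  shows "card {u \<in> vecs n. (a - b) * u = 0} = CARD('a) ^ agree n a b"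
proof -
  have "{u \<in> vecs n. (a - b) * u = 0} = PiE_dflt {..<n} 0 (\<lambda>i. if a i = b i then UNIV else {0})"
  proof (rule Set.set_eqI)
    fix u
    have "u \<in> {u \<in> vecs n. (a - b) * u = 0} \<longleftrightarrow> (\<forall>i. (\<not> i < n \<longrightarrow> u i = 0) \<and> (a i = b i \<or> u i = 0))"
      by (auto simp: vecs_iff fun_eq_iff not_less)
    also have "\<dots> \<longleftrightarrow> u \<in> PiE_dflt {..<n} 0 (\<lambda>i. if a i = b i then UNIV else {0})"
      unfolding PiE_dflt_def mem_Collect_eq by (intro all_cong1) auto
    finally show "u \<in> {u \<in> vecs n. (a - b) * u = 0}
      \<longleftrightarrow> u \<in> PiE_dflt {..<n} 0 (\<lambda>i. if a i = b i then UNIV else {0})" .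
  qed
  then have "card {u \<in> vecs n. (a - b) * u = 0} = (\<Prod>i<n. card (if a i = b i then UNIV else {0::'a}))"
    by (simp add: card_PiE_dflt)
  also have "\<dots> = (\<Prod>i<n. if a i = b i then CARD('a) else 1)"
    by (intro prod.cong) auto
  finally show ?thesis by (simp add: prod_agree)
qed

section \<open>First-moment bounds for logarithms\<close>

text \<open>From \<open>exp 1 \<le> 3\<close>. It absorbs the factor \<open>1 / ln 2\<close> that
  arises when \<open>ln x \<le> x - 1\<close> is applied to binary logarithms.\<close>

lemma inverse_ln_2_le_log:
  assumes "3 \<le> q"
  shows "1 / ln 2 \<le> log 2 (real q)"
proof -
  have "exp 1 \<le> real q" using exp_le assms by linarith
  moreover have "0 < real q" using assms by simp
  ultimately have "1 \<le> ln (real q)" by (simp only: ln_ge_iff)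
  then show ?thesis unfolding log_def by (rule divide_right_mono) simp
qed

text \<open>Lowering the base to 2 is essential for the later average. With base \<open>q\<close>
  the mean of \<open>q ^ agree\<close> would be \<open>(2 - 1 / q) ^ n\<close>, which exceeds
  \<open>q ^ m\<close> for \<open>q = 5\<close> and \<open>n = 3 * m\<close>; with base 2 the mean
  is \<open>(1 + 1 / q) ^ n\<close>, below \<open>2 ^ m\<close>.\<close>

lemma power_ratio_le:
  assumes q: "2 \<le> q" and k: "k \<le> m"
  shows "real q ^ k / real q ^ m \<le> 2 ^ k / 2 ^ m"
proof -
  have eq: "c ^ k / c ^ m = (1 / c) ^ (m - k)" if "c \<noteq> 0" for c :: real
    using k that by (simp add: power_divide power_diff)
  have "1 / real q \<le> 1 / 2" using q by (intro divide_left_mono) simp_all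
  then have "(1 / real q) ^ (m - k) \<le> (1 / 2) ^ (m - k)"
    by (rule power_mono) simp
  then show ?thesis using q by (simp only: eq)
qed

text \<open>Below the threshold \<open>k < m\<close> the estimate \<open>ln x \<le> x - 1\<close> is used, above it the trivial
  bound; both are dominated by \<open>2 ^ k / 2 ^ m\<close>, whose average over pairs of vectors is computable.\<close>

lemma sum_log_le:
  fixes x :: "'g \<Rightarrow> real"
  assumes n: "1 \<le> n" and q: "3 \<le> q"
    and pos: "\<And>G. G \<in> \<G> \<Longrightarrow> 0 < x G"
    and le: "\<And>G. G \<in> \<G> \<Longrightarrow> x G \<le> real q ^ n"
    and mean: "(\<Sum>G\<in>\<G>. x G) \<le> card \<G> * (1 + real q ^ k / real q ^ m)"
  shows "(\<Sum>G\<in>\<G>. log 2 (x G)) \<le> card \<G> * (n * log 2 q * (2 ^ k / 2 ^ m))"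
proof (cases "m \<le> k")
  case True
  have lq: "0 \<le> log 2 q" using q by simp
  have "1 \<le> (2 ^ k / 2 ^ m :: real)" using True by (simp add: power_increasing)
  then have *: "n * log 2 q * 1 \<le> n * log 2 q * (2 ^ k / 2 ^ m)"
    by (rule mult_left_mono) (use lq in simp)
  have "log 2 (x G) \<le> n * log 2 q * (2 ^ k / 2 ^ m)" if G: "G \<in> \<G>" for G
  proof -
    have "log 2 (x G) \<le> log 2 (real q ^ n)"
      using pos[OF G] le[OF G] q by simp
    also have "\<dots> = n * log 2 q * 1" using q by (simp add: log_nat_power)
    also note *
    finally show ?thesis .
  qed
  then show ?thesis by (rule sum_bounded_above)
next
  case False
  have lq: "1 / ln 2 \<le> log 2 q" using q by (rule inverse_ln_2_le_log)
  then have "0 \<le> log 2 q" using q by simp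
  then have nlq: "1 * log 2 q \<le> n * log 2 q" using n by (intro mult_right_mono) simp_all
  have ratio: "real q ^ k / real q ^ m \<le> 2 ^ k / 2 ^ m"
    using q False by (intro power_ratio_le) simp_all
  have "log 2 (x G) \<le> (x G - 1) * (1 / ln 2)" if G: "G \<in> \<G>" for G
    using ln_le_minus_one[OF pos[OF G]] by (simp add: log_def divide_right_mono)
  then have "(\<Sum>G\<in>\<G>. log 2 (x G)) \<le> (\<Sum>G\<in>\<G>. (x G - 1) * (1 / ln 2))"
    by (rule sum_mono)
  also have "\<dots> = ((\<Sum>G\<in>\<G>. x G) - card \<G>) * (1 / ln 2)"
    by (simp add: sum_subtractf flip: sum_divide_distrib)
  \<comment> \<open>The mean of \<open>x\<close> exceeds 1 by at most \<open>q ^ k / q ^ m\<close>,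
    and \<open>1 / ln 2\<close> is at most \<open>n * log 2 q\<close>.\<close>
  also have "\<dots> \<le> (card \<G> * (real q ^ k / real q ^ m)) * (n * log 2 q)"
    using mean lq nlq by (intro mult_mono) (simp_all add: distrib_left)
  also have "\<dots> \<le> (card \<G> * (2 ^ k / 2 ^ m)) * (n * log 2 q)"
    using ratio \<open>0 \<le> log 2 q\<close> by (intro mult_right_mono mult_left_mono) simp_all
  also have "\<dots> = card \<G> * (n * log 2 q * (2 ^ k / 2 ^ m))"
    by (simp only: mult_ac)
  finally show ?thesis .
qed

text \<open>Probabilistic method: the bound holds for the average over \<open>\<G>\<close> of the
  whole sum over \<open>P\<close>, hence for some single \<open>G\<close>.\<close>

lemma exists_small_log_sum:
  fixes x :: "'g \<Rightarrow> 'p \<Rightarrow> real" and e :: "'p \<Rightarrow> nat"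
  assumes \<G>: "finite \<G>" "\<G> \<noteq> {}" and n: "1 \<le> n" and q: "3 \<le> q"
    and pos: "\<And>G p. G \<in> \<G> \<Longrightarrow> p \<in> P \<Longrightarrow> 0 < x G p"
    and le: "\<And>G p. G \<in> \<G> \<Longrightarrow> p \<in> P \<Longrightarrow> x G p \<le> real q ^ n"
    and mean: "\<And>p. p \<in> P \<Longrightarrow> (\<Sum>G\<in>\<G>. x G p) \<le> card \<G> * (1 + real q ^ e p / real q ^ m)"
  shows "\<exists>G\<in>\<G>. (\<Sum>p\<in>P. log 2 (x G p)) \<le> n * log 2 q * (\<Sum>p\<in>P. 2 ^ e p) / 2 ^ m"
proof (rule ccontr)
  let ?R = "n * log 2 q * (\<Sum>p\<in>P. 2 ^ e p) / 2 ^ m"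
  assume "\<not> ?thesis"
  then have "?R < (\<Sum>p\<in>P. log 2 (x G p))" if "G \<in> \<G>" for G
    using that by (meson not_le)
  with \<G> have "(\<Sum>G\<in>\<G>. ?R) < (\<Sum>G\<in>\<G>. \<Sum>p\<in>P. log 2 (x G p))"
    by (rule sum_strict_mono)
  also have "\<dots> = (\<Sum>p\<in>P. \<Sum>G\<in>\<G>. log 2 (x G p))" by (rule sum.swap)
  also have "\<dots> \<le> (\<Sum>p\<in>P. card \<G> * (n * log 2 q * (2 ^ e p / 2 ^ m)))"
    by (intro sum_mono sum_log_le n q pos le mean)
  also have "\<dots> = (\<Sum>G\<in>\<G>. ?R)"
    by (simp add: sum_distrib_left sum_divide_distrib)
  finally show False by simp
qed

text \<open>A random matrix kills a non-zero \<open>w p u\<close> with probability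
  \<open>1 / CARD('a) ^ k\<close>, so the expected number of survivors in \<open>\<Delta> p\<close>
  is the left side of the last hypothesis. The scale \<open>s\<close> is the size these sets should
  typically have.\<close>

lemma exists_matrix_small_kernels:
  fixes w :: "'p \<Rightarrow> 'd \<Rightarrow> nat \<Rightarrow> 'a::{field,finite}" and e :: "'p \<Rightarrow> nat"
  assumes n: "1 \<le> n" and q: "3 \<le> CARD('a)" and s: "0 < s"
    and \<Delta>: "\<And>p. p \<in> P \<Longrightarrow> finite (\<Delta> p)" "\<And>p. p \<in> P \<Longrightarrow> card (\<Delta> p) \<le> s * real CARD('a) ^ n"
    and w: "\<And>p u. p \<in> P \<Longrightarrow> u \<in> \<Delta> p \<Longrightarrow> w p u \<in> vecs n"
    and z: "\<And>p. p \<in> P \<Longrightarrow> {u \<in> \<Delta> p. w p u = 0} \<noteq> {}"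
    and mean: "\<And>p. p \<in> P \<Longrightarrow> card {u \<in> \<Delta> p. w p u = 0} + card (\<Delta> p) / real CARD('a) ^ k
       \<le> s * (1 + real CARD('a) ^ e p / real CARD('a) ^ m)"
  shows "\<exists>M\<in>mats k n. (\<Sum>p\<in>P. log 2 (card {u \<in> \<Delta> p. matvec k n M (w p u) = 0} / s))
    \<le> n * log 2 CARD('a) * (\<Sum>p\<in>P. 2 ^ e p) / 2 ^ m"
proof (rule exists_small_log_sum[OF finite_mats mats_nonempty n q])
  let ?c = "\<lambda>M p. card {u \<in> \<Delta> p. matvec k n M (w p u) = 0}"
  fix p assume p: "p \<in> P"
  show "0 < ?c M p / s" for M
  proof -
    have "{u \<in> \<Delta> p. w p u = 0} \<subseteq> {u \<in> \<Delta> p. matvec k n M (w p u) = 0}" by auto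
    then have "0 < ?c M p" using z[OF p] \<Delta>(1)[OF p] by (subst card_gt_0_iff) auto
    then show ?thesis using s by simp
  qed
  show "?c M p / s \<le> real CARD('a) ^ n" for M
  proof -
    have "?c M p \<le> card (\<Delta> p)" using \<Delta>(1)[OF p] by (intro card_mono) auto
    then show ?thesis using \<Delta>(2)[OF p] s by (simp add: divide_simps mult.commute)
  qed
  let ?Ms = "mats k n :: (nat \<Rightarrow> nat \<Rightarrow> 'a) set"
  let ?T = "real (card ?Ms)"
  have 1: "(\<Sum>M\<in>?Ms. of_bool (matvec k n M (w p u) = 0))
      \<le> ?T * of_bool (w p u = 0) + ?T / real CARD('a) ^ k" if u: "u \<in> \<Delta> p" for u
  proof (cases "w p u = 0")
    case False
    have "(\<Sum>M\<in>?Ms. of_bool (matvec k n M (w p u) = 0))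
       = real (card {M \<in> ?Ms. matvec k n M (w p u) = 0})"
      by (simp add: of_bool_def sum.If_cases Int_def)
    also have "\<dots> = ?T / real CARD('a) ^ k"
      using card_mats_kernel[OF w[OF p u] False, of k] by (simp add: divide_simps flip: of_nat_power of_nat_mult)
    finally show ?thesis using False by simp
  qed simp
  have "(\<Sum>M\<in>?Ms. real (?c M p)) = (\<Sum>M\<in>?Ms. \<Sum>u\<in>\<Delta> p. of_bool (matvec k n M (w p u) = 0))"
    using \<Delta>(1)[OF p] by (intro sum.cong) (simp_all add: of_bool_def sum.If_cases Int_def)
  also have "\<dots> = (\<Sum>u\<in>\<Delta> p. \<Sum>M\<in>?Ms. of_bool (matvec k n M (w p u) = 0))"
    by (rule sum.swap)
  also have "\<dots> \<le> (\<Sum>u\<in>\<Delta> p. ?T * of_bool (w p u = 0) + ?T / real CARD('a) ^ k)"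
    by (intro sum_mono 1)
  also have "\<dots> = ?T * (\<Sum>u\<in>\<Delta> p. of_bool (w p u = 0)) + card (\<Delta> p) * (?T / real CARD('a) ^ k)"
    by (simp add: sum.distrib sum_distrib_left)
  also have "(\<Sum>u\<in>\<Delta> p. of_bool (w p u = 0)) = real (card {u \<in> \<Delta> p. w p u = 0})"
    using \<Delta>(1)[OF p] by (simp add: of_bool_def sum.If_cases Int_def)
  also have "?T * card {u \<in> \<Delta> p. w p u = 0} + card (\<Delta> p) * (?T / real CARD('a) ^ k)
      = ?T * (card {u \<in> \<Delta> p. w p u = 0} + card (\<Delta> p) / real CARD('a) ^ k)"
    by (simp add: algebra_simps)
  also have "\<dots> \<le> ?T * (s * (1 + real CARD('a) ^ e p / real CARD('a) ^ m))"
    using mean[OF p] by (rule mult_left_mono) simp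
  finally have "(\<Sum>M\<in>?Ms. real (?c M p))
      \<le> ?T * (1 + real CARD('a) ^ e p / real CARD('a) ^ m) * s"
    by (simp only: mult_ac)
  then show "(\<Sum>M\<in>?Ms. ?c M p / s) \<le> ?T * (1 + real CARD('a) ^ e p / real CARD('a) ^ m)"
    unfolding sum_divide_distrib[symmetric] pos_divide_le_eq[OF s] .
qed

section \<open>Lines and parabolas\<close>

text \<open>Leading coefficients of parabolas. Being non-zero in every coordinate, they can be
  cancelled, so that one intersection with a line determines the other.\<close>

definition units :: "nat \<Rightarrow> (nat \<Rightarrow> 'a::zero) set" where
  "units n = PiE_dflt {..<n} 0 (\<lambda>_. UNIV - {0})"

lemma units_vecs: "d \<in> units n \<Longrightarrow> d \<in> vecs n"
  by (auto simp: units_def vecs_def PiE_dflt_def)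

lemma finite_units [simp]: "finite (units n :: (nat \<Rightarrow> 'a::{zero,finite}) set)"
  by (auto simp: units_def)

lemma units_nonempty: "(units n :: (nat \<Rightarrow> 'a::{zero_neq_one}) set) \<noteq> {}"
proof -
  have "UNIV - {0 :: 'a} \<noteq> {}" using one_neq_zero by blast
  then show ?thesis by (auto simp: units_def)
qed

lemma units_cancel:
  fixes d :: "nat \<Rightarrow> 'a::field"
  assumes "d \<in> units n" "u \<in> vecs n" "v \<in> vecs n" "d * u = d * v"
  shows "u = v"
proof
  fix i
  have "d i * u i = d i * v i" using assms(4) by (metis times_fun_apply)
  then show "u i = v i"
    using assms(1-3) by (cases "i < n") (auto simp: units_def PiE_dflt_def vecs_iff)
qed

lemma units_inverse:
  fixes d :: "nat \<Rightarrow> 'a::field"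
  assumes "d \<in> units n"
  shows "\<exists>e. \<forall>v\<in>vecs n. d * (e * v) = v"
proof (intro exI ballI)
  show "d * ((\<lambda>i. inverse (d i)) * v) = v" if "v \<in> vecs n" for v
  proof
    fix i show "(d * ((\<lambda>i. inverse (d i)) * v)) i = v i"
      using assms that by (cases "i < n") (auto simp: units_def PiE_dflt_def vecs_iff)
  qed
qed

lemma card_le_fibre:
  assumes "finite W" "inj_on f S" "f ` S \<subseteq> fibre W X I w"
  shows "card S \<le> card (fibre W X I w)"
  using assms by (intro card_inj_on_le[of f]) (auto intro: finite_subset[OF fibre_subset])

text \<open>In each of \<open>n\<close> coordinates, \<open>C\<close> is the line \<open>y = c0 + c1 x\<close>, \<open>A\<close> and \<open>B\<close> are its points
  over \<open>a\<close> and \<open>b\<close>, and \<open>D\<close> is the parabola \<open>y = c0 + c1 x + d (x - a) (x - b)\<close> through them.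
  The vector of slopes is confined to \<open>K\<close>, and only the hash \<open>g\<close> of the ordinates of \<open>A\<close> is kept.\<close>

locale lines_and_parabolas =
  fixes n :: nat and K :: "(nat \<Rightarrow> 'a::{field,finite}) set" and g :: "(nat \<Rightarrow> 'a) \<Rightarrow> nat \<Rightarrow> 'a"
  assumes K_sub: "K \<subseteq> vecs n" and K_0: "0 \<in> K"
    and K_diff: "\<And>x y. x \<in> K \<Longrightarrow> y \<in> K \<Longrightarrow> x - y \<in> K"
    and g_diff: "\<And>x y. g (x - y) = g x - g y"
begin

definition W :: "((nat \<Rightarrow> 'a) \<times> (nat \<Rightarrow> 'a) \<times> (nat \<Rightarrow> 'a) \<times> (nat \<Rightarrow> 'a) \<times> (nat \<Rightarrow> 'a)) set" where
  "W = vecs n \<times> vecs n \<times> vecs n \<times> K \<times> units n"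

text \<open>\<open>D\<close> lists the coefficients of the parabola after expansion in powers of the
  abscissa. The padding by 0 gives all variables one type.\<close>

definition X :: "rvar \<Rightarrow> (nat \<Rightarrow> 'a) \<times> (nat \<Rightarrow> 'a) \<times> (nat \<Rightarrow> 'a) \<times> (nat \<Rightarrow> 'a) \<times> (nat \<Rightarrow> 'a)
    \<Rightarrow> (nat \<Rightarrow> 'a) \<times> (nat \<Rightarrow> 'a) \<times> (nat \<Rightarrow> 'a)" where
  "X i = (\<lambda>(a, b, c0, c1, d). case i of
     A \<Rightarrow> (a, g (c0 + c1 * a), 0) | B \<Rightarrow> (b, c0 + c1 * b, 0) | C \<Rightarrow> (c0, c1, 0)
   | D \<Rightarrow> (d, c1 - d * (a + b), c0 + d * (a * b)))"

abbreviation ent :: "rvar set \<Rightarrow> real" where "ent \<equiv> uniform_entropy W X"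
abbreviation lg :: "nat \<Rightarrow> real" where "lg k \<equiv> log 2 (real k)"

definition L :: "(nat \<Rightarrow> 'a) set" where "L = {v \<in> vecs n. g v = 0}"

text \<open>Slope changes that \<open>A\<close> and \<open>B\<close> do not detect: rotating the
  line about the point over \<open>b\<close> by \<open>u\<close> moves its ordinate over
  \<open>a\<close> by \<open>(a - b) * u\<close>.\<close>

definition ambiguity :: "(nat \<Rightarrow> 'a) \<Rightarrow> (nat \<Rightarrow> 'a) \<Rightarrow> (nat \<Rightarrow> 'a) set" where
  "ambiguity a b = {u \<in> K. g ((a - b) * u) = 0}"

text \<open>This average is \<open>H(C|A,B)\<close>, as \<open>cond_entropy\<close> shows.\<close>

definition \<alpha> :: real where
  "\<alpha> = (\<Sum>(a, b)\<in>vecs n \<times> vecs n. lg (card (ambiguity a b))) / (real CARD('a) ^ n) ^ 2"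

lemma K_vecs: "u \<in> K \<Longrightarrow> u \<in> vecs n"
  using K_sub by auto

lemma K_add: "x \<in> K \<Longrightarrow> y \<in> K \<Longrightarrow> x + y \<in> K"
  using K_diff[OF _ K_diff[OF K_0]] by fastforce

lemma g_0: "g 0 = 0"
  using g_diff[of 0 0] by simp

lemma g_diff_eq_0_iff: "g (x - y) = 0 \<longleftrightarrow> g x = g y"
  by (simp add: g_diff)

lemma finite_K: "finite K"
  using finite_subset[OF K_sub finite_vecs] .

lemma finite_L: "finite L"
  by (simp add: L_def)

lemma finite_W: "finite W"
  by (simp add: W_def finite_K)

lemma W_nonempty: "W \<noteq> {}"
  using K_0 units_nonempty vecs_closed(1)[of n] unfolding W_def by blast

lemma card_K_pos: "0 < card K"
  using K_0 finite_K by (auto simp: card_gt_0_iff)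

lemma card_L_pos: "0 < card L"
proof -
  have "0 \<in> L" by (simp add: L_def g_0)
  then show ?thesis using finite_L by (auto simp: card_gt_0_iff)
qed

lemma card_units_pos: "0 < card (units n :: (nat \<Rightarrow> 'a) set)"
  using units_nonempty by (auto simp: card_gt_0_iff)

lemma card_ambiguity_pos: "0 < card (ambiguity a b)"
proof -
  have "0 \<in> ambiguity a b" by (simp add: ambiguity_def g_0 K_0)
  then show ?thesis using finite_K by (auto simp: ambiguity_def card_gt_0_iff)
qed

lemma card_W: "card W = CARD('a) ^ n * CARD('a) ^ n * CARD('a) ^ n * card K * card (units n :: (nat \<Rightarrow> 'a) set)"
  by (simp add: W_def card_cartesian_product card_vecs)

section \<open>Fibre counts in the model\<close>

lemmas model_simps = fibre_def W_def X_def

lemma card_fibre_C: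
  assumes "w \<in> W"
  shows "card (fibre W X {C} w) = CARD('a) ^ n * CARD('a) ^ n * card (units n :: (nat \<Rightarrow> 'a) set)"
proof -
  obtain a b c0 c1 d where w: "w = (a, b, c0, c1, d)" by (metis prod_cases5)
  have "fibre W X {C} w = vecs n \<times> vecs n \<times> {c0} \<times> {c1} \<times> units n"
    using assms by (auto simp: model_simps w)
  then show ?thesis by (simp add: card_cartesian_product card_vecs)
qed

lemma card_fibre_AC:
  assumes "w \<in> W"
  shows "card (fibre W X {A, C} w) = CARD('a) ^ n * card (units n :: (nat \<Rightarrow> 'a) set)"
proof -
  obtain a b c0 c1 d where w: "w = (a, b, c0, c1, d)" by (metis prod_cases5)
  have "fibre W X {A, C} w = {a} \<times> vecs n \<times> {c0} \<times> {c1} \<times> units n"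
    using assms by (auto simp: model_simps w)
  then show ?thesis by (simp add: card_cartesian_product card_vecs)
qed

lemma card_fibre_BC:
  assumes "w \<in> W"
  shows "card (fibre W X {B, C} w) = CARD('a) ^ n * card (units n :: (nat \<Rightarrow> 'a) set)"
proof -
  obtain a b c0 c1 d where w: "w = (a, b, c0, c1, d)" by (metis prod_cases5)
  have "fibre W X {B, C} w = vecs n \<times> {b} \<times> {c0} \<times> {c1} \<times> units n"
    using assms by (auto simp: model_simps w)
  then show ?thesis by (simp add: card_cartesian_product card_vecs)
qed

lemma card_fibre_ABC:
  assumes "w \<in> W"
  shows "card (fibre W X {A, B, C} w) = card (units n :: (nat \<Rightarrow> 'a) set)"
proof -
  obtain a b c0 c1 d where w: "w = (a, b, c0, c1, d)" by (metis prod_cases5)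
  have "fibre W X {A, B, C} w = {a} \<times> {b} \<times> {c0} \<times> {c1} \<times> units n"
    using assms by (auto simp: model_simps w)
  then show ?thesis by (simp add: card_cartesian_product)
qed

text \<open>Keep the parabola and the point over \<open>a\<close>. Each slope \<open>k\<close> in
  \<open>K\<close> gives a line through that point, and its second intersection with the parabola
  supplies the new \<open>b\<close>.\<close>

lemma card_fibre_AD:
  assumes "w \<in> W"
  shows "card K \<le> card (fibre W X {A, D} w)"
proof -
  obtain a b c0 c1 d where w: "w = (a, b, c0, c1, d)" by (metis prod_cases5)
  have in_W: "a \<in> vecs n" "b \<in> vecs n" "c0 \<in> vecs n" "c1 \<in> K" "d \<in> units n"
    using assms by (auto simp: W_def w)
  \<comment> \<open>Multiplication by \<open>e\<close> divides by the leading coefficient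
    \<open>d\<close>.\<close>
  obtain e where e: "\<And>v. v \<in> vecs n \<Longrightarrow> d * (e * v) = v" 
    using units_inverse[OF in_W(5)] by blast
  define f where "f k = (a, b + e * (k - c1), c0 + c1 * a - k * a, k, d)" for k
  have "f k \<in> fibre W X {A, D} w" if k: "k \<in> K" for k
  proof -
    have kv: "k - c1 \<in> vecs n" using k in_W K_vecs by simp
    have "d * (a + (b + e * (k - c1))) = d * (a + b) + d * (e * (k - c1))"
      by (simp only: distrib_left add.assoc)
    then have 1: "k - d * (a + (b + e * (k - c1))) = c1 - d * (a + b)"
      by (simp add: e[OF kv])
    have "d * (a * (b + e * (k - c1))) = d * (a * b) + a * (d * (e * (k - c1)))"
      by (simp only: distrib_left mult_ac)
    then have 2: "c0 + c1 * a - k * a + d * (a * (b + e * (k - c1))) = c0 + d * (a * b)"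
      by (simp only: e[OF kv]) (simp add: algebra_simps)
    show ?thesis
      using in_W k kv by (auto simp: model_simps w f_def 1 2 K_vecs)
  qed
  then have "f ` K \<subseteq> fibre W X {A, D} w" by blast
  moreover have "inj_on f K" by (auto simp: inj_on_def f_def)
  ultimately show ?thesis using finite_W by (intro card_le_fibre)
qed

text \<open>The same pencil of lines, now through the point over \<open>b\<close>.\<close>

lemma card_fibre_BD:
  assumes "w \<in> W"
  shows "card K \<le> card (fibre W X {B, D} w)"
proof -
  obtain a b c0 c1 d where w: "w = (a, b, c0, c1, d)" by (metis prod_cases5)
  have in_W: "a \<in> vecs n" "b \<in> vecs n" "c0 \<in> vecs n" "c1 \<in> K" "d \<in> units n"
    using assms by (auto simp: W_def w)
  obtain e where e: "\<And>v. v \<in> vecs n \<Longrightarrow> d * (e * v) = v" 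
    using units_inverse[OF in_W(5)] by blast
  define f where "f k = (a + e * (k - c1), b, c0 + c1 * b - k * b, k, d)" for k
  have "f k \<in> fibre W X {B, D} w" if k: "k \<in> K" for k
  proof -
    have kv: "k - c1 \<in> vecs n" using k in_W K_vecs by simp
    have "d * (a + e * (k - c1) + b) = d * (a + b) + d * (e * (k - c1))"
      by (simp only: distrib_left add_ac)
    then have 1: "k - d * (a + e * (k - c1) + b) = c1 - d * (a + b)"
      by (simp add: e[OF kv])
    have "d * ((a + e * (k - c1)) * b) = d * (a * b) + b * (d * (e * (k - c1)))"
      by (simp only: distrib_left distrib_right mult_ac)
    then have 2: "c0 + c1 * b - k * b + d * ((a + e * (k - c1)) * b) = c0 + d * (a * b)"
      by (simp only: e[OF kv]) (simp add: algebra_simps)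
    show ?thesis
      using in_W k kv by (auto simp: model_simps w f_def 1 2 K_vecs)
  qed
  then have "f ` K \<subseteq> fibre W X {B, D} w" by blast
  moreover have "inj_on f K" by (auto simp: inj_on_def f_def)
  ultimately show ?thesis using finite_W by (intro card_le_fibre)
qed

text \<open>Line and parabola fix only the unordered pair of intersections, so \<open>a\<close> and
  \<open>b\<close> can be exchanged independently in every coordinate where they differ.\<close>

lemma card_fibre_CD:
  assumes "(a, b, c0, c1, d) \<in> W"
  shows "2 ^ (n - agree n a b) \<le> card (fibre W X {C, D} (a, b, c0, c1, d))"
proof -
  have in_W: "a \<in> vecs n" "b \<in> vecs n" "c0 \<in> vecs n" "c1 \<in> K" "d \<in> units n"
    using assms by (auto simp: W_def)
  define S where "S = PiE_dflt {..<n} 0 (\<lambda>i. {a i, b i})"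
  define f where "f u = (u, a + b - u, c0, c1, d)" for u
  have S: "u \<in> vecs n" "u * (a + b - u) = a * b" if "u \<in> S" for u
  proof -
    show "u \<in> vecs n" using that by (auto simp: S_def PiE_dflt_def vecs_iff)
    show "u * (a + b - u) = a * b"
    proof
      fix i
      have "u i = a i \<or> u i = b i"
        using that in_W by (cases "i < n") (auto simp: S_def PiE_dflt_def vecs_iff)
      then show "(u * (a + b - u)) i = (a * b) i" by auto
    qed
  qed
  have "f u \<in> fibre W X {C, D} (a, b, c0, c1, d)" if "u \<in> S" for u
    using in_W S[OF that] by (auto simp: model_simps f_def)
  then have "f ` S \<subseteq> fibre W X {C, D} (a, b, c0, c1, d)" by blast
  moreover have "inj_on f S" by (auto simp: inj_on_def f_def)
  ultimately have "card S \<le> card (fibre W X {C, D} (a, b, c0, c1, d))"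
    using finite_W by (intro card_le_fibre)
  moreover have "card S = 2 ^ (n - agree n a b)"
  proof -
    \<comment> \<open>In each coordinate the two factors multiply to 2, whether or not
      \<open>a\<close> and \<open>b\<close> agree there.\<close>
    have "card S * 2 ^ agree n a b
        = (\<Prod>i<n. card {a i, b i}) * (\<Prod>i<n. if a i = b i then 2 else 1)"
      by (simp add: S_def card_PiE_dflt prod_agree)
    also have "\<dots> = (\<Prod>i<n. 2)"
      unfolding prod.distrib[symmetric] by (intro prod.cong) auto
    also have "\<dots> = 2 ^ (n - agree n a b) * 2 ^ agree n a b"
      by (simp add: agree_le flip: power_add)
    finally show ?thesis by simp
  qed
  ultimately show ?thesis by simp
qed

text \<open>The linear coefficient of the parabola yields \<open>d * b\<close>, and \<open>d\<close>
  can be cancelled.\<close>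

lemma card_fibre_ACD:
  assumes "w \<in> W"
  shows "card (fibre W X {A, C, D} w) \<le> 1"
proof -
  obtain a b c0 c1 d where w: "w = (a, b, c0, c1, d)" by (metis prod_cases5)
  have "x = w" if x: "x \<in> fibre W X {A, C, D} w" for x
  proof -
    obtain b' where x': "x = (a, b', c0, c1, d)" "b' \<in> vecs n"
      and *: "c1 - d * (a + b') = c1 - d * (a + b)"
      using x by (auto simp: model_simps w)
    have "d * b' = d * b" using * by (simp add: distrib_left)
    moreover have "d \<in> units n" "b \<in> vecs n" using assms by (auto simp: W_def w)
    ultimately have "b' = b" using units_cancel x'(2) by blast
    then show ?thesis by (simp add: x' w)
  qed
  then have "fibre W X {A, C, D} w \<subseteq> {w}" by blast
  from card_mono[OF _ this] show ?thesis by simp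
qed

lemma card_fibre_BCD:
  assumes "w \<in> W"
  shows "card (fibre W X {B, C, D} w) \<le> 1"
proof -
  obtain a b c0 c1 d where w: "w = (a, b, c0, c1, d)" by (metis prod_cases5)
  have "x = w" if x: "x \<in> fibre W X {B, C, D} w" for x
  proof -
    obtain a' where x': "x = (a', b, c0, c1, d)" "a' \<in> vecs n"
      and *: "c1 - d * (a' + b) = c1 - d * (a + b)"
      using x by (auto simp: model_simps w)
    have "d * a' = d * a" using * by (simp add: distrib_left)
    moreover have "d \<in> units n" "a \<in> vecs n" using assms by (auto simp: W_def w)
    ultimately have "a' = a" using units_cancel x'(2) by blast
    then show ?thesis by (simp add: x' w)
  qed
  then have "fibre W X {B, C, D} w \<subseteq> {w}" by blast
  from card_mono[OF _ this] show ?thesis by simp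
qed

text \<open>Given the parabola, the slope and \<open>a\<close> determine \<open>b\<close> from the
  linear coefficient and then \<open>c0\<close> from the constant one.\<close>

lemma card_fibre_D:
  assumes "w \<in> W"
  shows "card (fibre W X {D} w) \<le> card K * CARD('a) ^ n"
proof -
  obtain a b c0 c1 d where w: "w = (a, b, c0, c1, d)" by (metis prod_cases5)
  define f :: "(nat \<Rightarrow> 'a) \<times> (nat \<Rightarrow> 'a) \<times> (nat \<Rightarrow> 'a) \<times> (nat \<Rightarrow> 'a) \<times> (nat \<Rightarrow> 'a) \<Rightarrow> _"
    where "f = (\<lambda>(a, b, c0, c1, d). (c1, a))"
  have "inj_on f (fibre W X {D} w)"
  proof (rule inj_onI)
    fix x y
    assume xy: "x \<in> fibre W X {D} w" "y \<in> fibre W X {D} w" "f x = f y"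
    obtain a' b' c0' k d' where x: "x = (a', b', c0', k, d')" by (metis prod_cases5)
    from xy(3) obtain b'' c0'' d'' where y: "y = (a', b'', c0'', k, d'')"
      by (cases y) (auto simp: f_def x)
    have d: "d' = d" "d'' = d" using xy(1,2) by (auto simp: model_simps w x y)
    have "k - d * (a' + b') = k - d * (a' + b'')"
      and c: "c0' + d * (a' * b') = c0'' + d * (a' * b'')"
      using xy(1,2) unfolding d x y by (auto simp: model_simps w)
    then have "d * b' = d * b''" by (simp add: distrib_left)
    then have "b' = b''"
      by (rule units_cancel[rotated 3]) (use xy(1,2) in \<open>auto simp: model_simps w x y d\<close>)
    with c show "x = y" by (simp add: x y d)
  qed
  moreover have "f ` fibre W X {D} w \<subseteq> K \<times> vecs n" by (auto simp: f_def model_simps)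
  ultimately have "card (fibre W X {D} w) \<le> card (K \<times> (vecs n :: (nat \<Rightarrow> 'a) set))"
    using finite_K by (intro card_inj_on_le) auto
  then show ?thesis by (simp add: card_cartesian_product card_vecs)
qed

text \<open>For any slope, the hashed ordinate over \<open>a\<close> fixes \<open>c0\<close> up to
  an element of \<open>L\<close>; \<open>b\<close> and \<open>d\<close> are free.\<close>

lemma card_fibre_A:
  assumes "w \<in> W"
  shows "card (fibre W X {A} w) = card K * CARD('a) ^ n * card (units n :: (nat \<Rightarrow> 'a) set) * card L"
proof -
  obtain a b c0 c1 d where w: "w = (a, b, c0, c1, d)" by (metis prod_cases5)
  have in_W: "a \<in> vecs n" "c0 \<in> vecs n" "c1 \<in> vecs n"
    using assms K_vecs by (auto simp: W_def w)
  define f where "f = (\<lambda>(k, b' :: nat \<Rightarrow> 'a, d', l). (a, b', c0 + c1 * a - l - k * a, k, d' :: nat \<Rightarrow> 'a))"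
  have "fibre W X {A} w = f ` (K \<times> vecs n \<times> units n \<times> L)"
  proof (intro equalityI subsetI)
    fix x assume "x \<in> fibre W X {A} w"
    then obtain b' c0' k d' where x: "x = (a, b', c0', k, d')"
      and *: "b' \<in> vecs n" "c0' \<in> vecs n" "k \<in> K" "d' \<in> units n" "g (c0' + k * a) = g (c0 + c1 * a)"
      by (auto simp: model_simps w)
    have "g ((c0 + c1 * a) - (c0' + k * a)) = 0" unfolding g_diff *(5) by simp
    then have "(c0 + c1 * a) - (c0' + k * a) \<in> L" using in_W * K_vecs by (simp add: L_def)
    moreover have "x = f (k, b', d', (c0 + c1 * a) - (c0' + k * a))" by (simp add: x f_def)
    ultimately show "x \<in> f ` (K \<times> vecs n \<times> units n \<times> L)" using * by blast
  next
    fix x assume "x \<in> f ` (K \<times> vecs n \<times> units n \<times> L)"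
    then show "x \<in> fibre W X {A} w"
      using in_W by (auto simp: model_simps w f_def L_def g_diff K_vecs)
  qed
  moreover have "inj_on f (K \<times> vecs n \<times> units n \<times> L)"
    by (auto simp: inj_on_def f_def)
  ultimately show ?thesis by (simp add: card_image card_cartesian_product card_vecs)
qed

lemma card_fibre_B:
  assumes "w \<in> W"
  shows "card (fibre W X {B} w) = card K * CARD('a) ^ n * card (units n :: (nat \<Rightarrow> 'a) set)"
proof -
  obtain a b c0 c1 d where w: "w = (a, b, c0, c1, d)" by (metis prod_cases5)
  have in_W: "b \<in> vecs n" "c0 \<in> vecs n" "c1 \<in> vecs n"
    using assms K_vecs by (auto simp: W_def w)
  define f where "f = (\<lambda>(k, a' :: nat \<Rightarrow> 'a, d'). (a', b, c0 + c1 * b - k * b, k, d' :: nat \<Rightarrow> 'a))"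
  have "fibre W X {B} w = f ` (K \<times> vecs n \<times> units n)"
  proof (intro equalityI subsetI)
    fix x assume "x \<in> fibre W X {B} w"
    then obtain a' c0' k d' where x: "x = (a', b, c0', k, d')"
      and *: "a' \<in> vecs n" "k \<in> K" "d' \<in> units n" "c0' + k * b = c0 + c1 * b"
      by (auto simp: model_simps w)
    have "x = f (k, a', d')" by (simp add: x f_def flip: *(4))
    then show "x \<in> f ` (K \<times> vecs n \<times> units n)" using * by blast
  next
    fix x assume "x \<in> f ` (K \<times> vecs n \<times> units n)"
    then show "x \<in> fibre W X {B} w"
      using in_W by (auto simp: model_simps w f_def K_vecs)
  qed
  moreover have "inj_on f (K \<times> vecs n \<times> units n)"
    by (auto simp: inj_on_def f_def)
  ultimately show ?thesis by (simp add: card_image card_cartesian_product card_vecs)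
qed

text \<open>The lines compatible with both points are the rotations about the point over
  \<open>b\<close> by elements of the ambiguity set.\<close>

lemma card_fibre_AB:
  assumes "(a, b, c0, c1, d) \<in> W"
  shows "card (fibre W X {A, B} (a, b, c0, c1, d))
    = card (ambiguity a b) * card (units n :: (nat \<Rightarrow> 'a) set)"
proof -
  have in_W: "a \<in> vecs n" "b \<in> vecs n" "c0 \<in> vecs n" "c1 \<in> K"
    using assms by (auto simp: W_def)
  define f where "f = (\<lambda>(u, d'). (a, b, c0 - u * b, c1 + u, d' :: nat \<Rightarrow> 'a))"
  have "fibre W X {A, B} (a, b, c0, c1, d) = f ` (ambiguity a b \<times> units n)"
  proof (intro equalityI subsetI)
    fix x assume "x \<in> fibre W X {A, B} (a, b, c0, c1, d)"
    then obtain c0' k d' where x: "x = (a, b, c0', k, d')"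
      and *: "k \<in> K" "d' \<in> units n" "g (c0' + k * a) = g (c0 + c1 * a)"
        "c0' + k * b = c0 + c1 * b"
      by (auto simp: model_simps)
    have c0': "c0' = c0 - (k - c1) * b" using *(4) by (simp add: algebra_simps)
    have "(a - b) * (k - c1) = (c0' + k * a) - (c0 + c1 * a)"
      unfolding c0' by (simp add: algebra_simps)
    then have "k - c1 \<in> ambiguity a b"
      using * in_W by (simp add: ambiguity_def K_diff g_diff)
    moreover have "x = f (k - c1, d')" by (simp add: x f_def c0')
    ultimately show "x \<in> f ` (ambiguity a b \<times> units n)" using * by blast
  next
    fix x assume "x \<in> f ` (ambiguity a b \<times> units n)"
    then obtain u d' where x: "x = f (u, d')"
      and *: "u \<in> K" "g ((a - b) * u) = 0" "d' \<in> units n"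
      by (auto simp: ambiguity_def)
    have eq: "(a - b) * u = (c0 - u * b + (c1 + u) * a) - (c0 + c1 * a)"
      by (simp add: algebra_simps)
    have "g (c0 - u * b + (c1 + u) * a) = g (c0 + c1 * a)"
      using *(2) unfolding eq g_diff_eq_0_iff .
    moreover have "c0 - u * b + (c1 + u) * b = c0 + c1 * b" by (simp add: algebra_simps)
    ultimately show "x \<in> fibre W X {A, B} (a, b, c0, c1, d)"
      using in_W * by (auto simp: model_simps f_def x K_add K_vecs)
  qed
  moreover have "inj_on f (ambiguity a b \<times> units n)"
    by (auto simp: inj_on_def f_def)
  ultimately show ?thesis by (simp add: card_image card_cartesian_product)
qed

section \<open>Entropies of the model\<close>

lemma \<alpha>_nonneg: "0 \<le> \<alpha>"
  using card_ambiguity_pos unfolding \<alpha>_def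
  by (auto intro!: divide_nonneg_nonneg sum_nonneg simp: Suc_leI)

lemma \<alpha>_le:
  assumes "(\<Sum>(a, b)\<in>vecs n \<times> vecs n. lg (card (ambiguity a b))) \<le> c * (real CARD('a) ^ n)\<^sup>2"
  shows "\<alpha> \<le> c"
  using assms by (simp add: \<alpha>_def pos_divide_le_eq)

text \<open>The map \<open>u \<mapsto> g ((a - b) * u)\<close> has its image inside that of
  \<open>g\<close>, so its kernel is at least as large as \<open>L\<close>. By
  \<open>mutual_information\<close> this is \<open>I(A:B) \<ge> 0\<close> for unrestricted
  slopes.\<close>

lemma log_card_L_le_\<alpha>:
  assumes K: "K = vecs n"
  shows "lg (card L) \<le> \<alpha>"
proof -
  let ?V = "vecs n :: (nat \<Rightarrow> 'a) set"
  have "card L \<le> card (ambiguity a b)" for a b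
  proof -
    let ?h = "\<lambda>u. g ((a - b) * u)"
    have "card ?V = card (g ` vecs n) * card L"
      unfolding L_def by (rule card_eq_image_times_kernel) (auto simp: g_diff)
    moreover have "card K = card (?h ` K) * card (ambiguity a b)"
      unfolding ambiguity_def
      by (rule card_eq_image_times_kernel) (auto simp: finite_K K_diff right_diff_distrib g_diff)
    ultimately have "card (g ` vecs n) * card L = card (?h ` K) * card (ambiguity a b)"
      by (simp add: K)
    also have "\<dots> \<le> card (g ` vecs n) * card (ambiguity a b)"
      by (intro mult_right_mono card_mono) (auto simp: K)
    finally have "card (g ` vecs n) * card L \<le> card (g ` vecs n) * card (ambiguity a b)" .
    moreover have "0 < card (g ` vecs n)"
      by (simp add: card_gt_0_iff)
    ultimately show ?thesis by simp
  qed
  then have "(\<Sum>(a, b)\<in>?V \<times> ?V. lg (card L)) \<le> (\<Sum>(a, b)\<in>?V \<times> ?V. lg (card (ambiguity a b)))"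
    using card_L_pos by (intro sum_mono) (simp add: case_prod_unfold log2_of_nat_mono)
  also have "(\<Sum>(a, b)\<in>?V \<times> ?V. lg (card L)) = lg (card L) * (real CARD('a) ^ n)\<^sup>2"
    by (simp add: case_prod_unfold card_cartesian_product card_vecs power2_eq_square)
  finally show ?thesis by (simp add: \<alpha>_def pos_le_divide_eq)
qed

text \<open>Under the uniform distribution on \<open>W\<close> the pair of abscissae is
  uniform.\<close>

lemma sum_W:
  fixes h :: "(nat \<Rightarrow> 'a) \<Rightarrow> (nat \<Rightarrow> 'a) \<Rightarrow> real"
  shows "(\<Sum>(a, b, c0, c1, d)\<in>W. h a b) / card W
    = (\<Sum>(a, b)\<in>vecs n \<times> vecs n. h a b) / (real CARD('a) ^ n) ^ 2"
proof -
  have "(\<Sum>(a, b, c0, c1, d)\<in>W. h a b) = card (vecs n :: (nat \<Rightarrow> 'a) set) * card K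
      * card (units n :: (nat \<Rightarrow> 'a) set) * (\<Sum>(a, b)\<in>vecs n \<times> vecs n. h a b)"
    by (simp add: W_def sum.cartesian_product' card_cartesian_product sum_distrib_left mult_ac)
  then show ?thesis
    using card_K_pos by (simp add: card_W card_vecs power2_eq_square units_nonempty)
qed

lemma ent_AB: "ent {A, B} = lg (card W) - lg (card (units n :: (nat \<Rightarrow> 'a) set)) - \<alpha>"
proof -
  let ?u = "lg (card (units n :: (nat \<Rightarrow> 'a) set))"
  have "(\<Sum>w\<in>W. lg (card (fibre W X {A, B} w)))
    = (\<Sum>(a, b, c0, c1, d)\<in>W. lg (card (ambiguity a b)) + ?u)"
    using card_ambiguity_pos card_units_pos
    by (intro sum.cong) (auto simp: card_fibre_AB log_mult)
  then have "(\<Sum>w\<in>W. lg (card (fibre W X {A, B} w))) / card W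
    = (\<Sum>(a, b)\<in>vecs n \<times> vecs n. lg (card (ambiguity a b)) + ?u) / (real CARD('a) ^ n) ^ 2"
    by (simp only: sum_W)
  also have "(\<Sum>(a, b)\<in>vecs n \<times> vecs n. lg (card (ambiguity a b)) + ?u)
    = (\<Sum>(a, b)\<in>vecs n \<times> vecs n. lg (card (ambiguity a b))) + (real CARD('a) ^ n) ^ 2 * ?u"
    by (simp add: case_prod_unfold sum.distrib card_cartesian_product card_vecs power2_eq_square)
  finally show ?thesis by (simp add: uniform_entropy_def \<alpha>_def add_divide_distrib)
qed

lemma ent_CD: "ent {C, D} \<le> lg (card W) - n * (1 - 1 / CARD('a))"
proof -
  have "(\<Sum>(a, b, c0, c1, d)\<in>W. real (n - agree n a b)) \<le> (\<Sum>w\<in>W. lg (card (fibre W X {C, D} w)))"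
  proof (rule sum_mono, clarify)
    fix a b c0 c1 d assume w: "(a, b, c0, c1, d) \<in> W"
    have "lg (2 ^ (n - agree n a b)) \<le> lg (card (fibre W X {C, D} (a, b, c0, c1, d)))"
      by (rule log2_of_nat_mono[OF _ card_fibre_CD[OF w]]) simp
    then show "real (n - agree n a b) \<le> lg (card (fibre W X {C, D} (a, b, c0, c1, d)))"
      by (simp add: log_nat_power)
  qed
  then have "(\<Sum>(a, b, c0, c1, d)\<in>W. real (n - agree n a b)) / card W
     \<le> (\<Sum>w\<in>W. lg (card (fibre W X {C, D} w))) / card W"
    by (rule divide_right_mono) simp
  moreover have "(\<Sum>(a :: nat \<Rightarrow> 'a, b)\<in>vecs n \<times> (vecs n :: (nat \<Rightarrow> 'a) set). real (n - agree n a b)) / (real CARD('a) ^ n)\<^sup>2 = n * (1 - 1 / CARD('a))"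
  proof -
    have "(\<Sum>(a :: nat \<Rightarrow> 'a, b)\<in>vecs n \<times> (vecs n :: (nat \<Rightarrow> 'a) set). real (n - agree n a b))
      = (\<Sum>a\<in>vecs n. \<Sum>b\<in>vecs n. real (n - agree n a (b :: nat \<Rightarrow> 'a)))"
      by (rule sum.cartesian_product[symmetric])
    also have "\<dots> = (\<Sum>a\<in>(vecs n :: (nat \<Rightarrow> 'a) set). n * (1 - 1 / CARD('a)) * CARD('a) ^ n)"
      by (intro sum.cong refl sum_disagree)
    finally show ?thesis by (simp add: card_vecs power2_eq_square)
  qed
  ultimately show ?thesis unfolding uniform_entropy_def sum_W by linarith
qed

lemmas ent_eq = uniform_entropy_const[OF finite_W W_nonempty]
lemmas ent_le = uniform_entropy_le_const[OF finite_W W_nonempty]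
lemmas ent_ge = uniform_entropy_ge_const[OF finite_W W_nonempty]
lemmas log_simps = log_mult log_nat_power card_K_pos card_L_pos units_nonempty

lemma cond_independence: "ent {A, C} + ent {B, C} - ent {A, B, C} - ent {C} = 0"
  by (simp add: ent_eq[OF card_fibre_C] ent_eq[OF card_fibre_AC] ent_eq[OF card_fibre_BC]
    ent_eq[OF card_fibre_ABC] log_simps)

lemma cond_entropy: "ent {A, B, C} - ent {A, B} = \<alpha>"
  by (simp add: ent_eq[OF card_fibre_ABC] ent_AB)

lemma mutual_information:
  "ent {A} + ent {B} - ent {A, B} = n * lg CARD('a) - lg (card K) - lg (card L) + \<alpha>"
  by (simp add: ent_eq[OF card_fibre_A] ent_eq[OF card_fibre_B] ent_AB card_W log_simps)

text \<open>The left side is the Ingleton expression: \<open>H(A)\<close> and \<open>H(B)\<close>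
  cancel in it. The negative term comes from the exchanges counted in
  \<open>card_fibre_CD\<close>.\<close>

lemma ingleton_le:
  "ent {A, C} + ent {A, D} + ent {B, C} + ent {B, D} + ent {C, D}
    - ent {A, C, D} - ent {B, C, D} - ent {A, B} - ent {C} - ent {D}
   \<le> n * lg CARD('a) - lg (card K) + \<alpha> - n * (1 - 1 / CARD('a))"
proof -
  have "ent {A, D} \<le> lg (card W) - lg (card K)" "ent {B, D} \<le> lg (card W) - lg (card K)"
    "lg (card W) - lg 1 \<le> ent {A, C, D}" "lg (card W) - lg 1 \<le> ent {B, C, D}"
    "lg (card W) - lg (card K * CARD('a) ^ n) \<le> ent {D}"
    by (intro ent_le ent_ge card_K_pos card_fibre_AD card_fibre_BD card_fibre_ACD
      card_fibre_BCD card_fibre_D; assumption)+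
  then show ?thesis
    using ent_CD
    by (simp add: ent_eq[OF card_fibre_C] ent_eq[OF card_fibre_AC] ent_eq[OF card_fibre_BC]
      ent_AB log_simps)
qed

lemma log_card_W_le: "lg (card W) \<le> 5 * lg CARD('a) * n"
proof -
  have K: "card K \<le> CARD('a) ^ n"
    using card_mono[OF finite_vecs K_sub] by (simp add: card_vecs)
  have U: "card (units n :: (nat \<Rightarrow> 'a) set) \<le> CARD('a) ^ n"
    using card_mono[OF finite_vecs, of "units n :: (nat \<Rightarrow> 'a) set" n] units_vecs
    by (auto simp: card_vecs)
  have "card W \<le> CARD('a) ^ n * CARD('a) ^ n * CARD('a) ^ n * CARD('a) ^ n * CARD('a) ^ n"
    unfolding card_W by (intro mult_mono K U) auto
  then have "lg (card W) \<le> lg (CARD('a) ^ n * CARD('a) ^ n * CARD('a) ^ n * CARD('a) ^ n * CARD('a) ^ n)"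
    using finite_W W_nonempty by (intro log2_of_nat_mono) (auto simp: card_gt_0_iff)
  then show ?thesis by (simp add: log_mult log_nat_power mult_ac)
qed

end

section \<open>Almost entropic limits\<close>

text \<open>\<open>log 2 q\<close> times the mean of \<open>2 ^ agree n a b / 2 ^ m\<close> over
  pairs of vectors: the error per coordinate left by a good matrix.\<close>

definition rate :: "nat \<Rightarrow> nat \<Rightarrow> nat \<Rightarrow> real" where
  "rate q n m = log 2 q * (1 + 1 / q) ^ n / 2 ^ m"

lemma sum_agree_pairs:
  "(\<Sum>(a, b)\<in>vecs n \<times> (vecs n :: (nat \<Rightarrow> 'a::{zero,finite}) set). (2::real) ^ agree n a b)
    = (real CARD('a) ^ n)\<^sup>2 * (1 + 1 / CARD('a)) ^ n"
proof -
  have "(\<Sum>(a, b)\<in>vecs n \<times> (vecs n :: (nat \<Rightarrow> 'a) set). (2::real) ^ agree n a b)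
    = (\<Sum>a\<in>vecs n. \<Sum>b\<in>(vecs n :: (nat \<Rightarrow> 'a) set). 2 ^ agree n a b)"
    by (rule sum.cartesian_product[symmetric])
  also have "\<dots> = real CARD('a) ^ n * (real CARD('a) + 1) ^ n"
    by (simp add: sum_two_power_agree card_vecs)
  also have "real CARD('a) + 1 = real CARD('a) * (1 + 1 / CARD('a))"
    by (simp add: field_simps)
  finally show ?thesis by (simp add: power_mult_distrib power2_eq_square)
qed

text \<open>The image lies in \<open>vecs k\<close>, so the kernel has codimension at most
  \<open>k\<close>.\<close>

lemma card_matvec_kernel:
  fixes M :: "nat \<Rightarrow> nat \<Rightarrow> 'a::{field,finite}"
  shows "real CARD('a) ^ n \<le> real CARD('a) ^ k * card {v \<in> vecs n. matvec k n M v = 0}"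
proof -
  have "card (vecs n :: (nat \<Rightarrow> 'a) set)
    = card (matvec k n M ` vecs n) * card {v \<in> vecs n. matvec k n M v = 0}"
    by (rule card_eq_image_times_kernel) (auto simp: matvec_diff)
  moreover have "card (matvec k n M ` vecs n) \<le> card (vecs k :: (nat \<Rightarrow> 'a) set)"
    by (intro card_mono) auto
  ultimately have "CARD('a) ^ n \<le> CARD('a) ^ k * card {v \<in> vecs n. matvec k n M v = 0}"
    by (simp add: card_vecs)
  then show ?thesis by (simp flip: of_nat_power of_nat_mult)
qed

text \<open>Slopes confined to the kernel of a random matrix: whenever \<open>A\<close> and \<open>B\<close> coincide on few
  coordinates only, they determine the line.\<close>

lemma exists_determined_line:
  assumes n: "1 \<le> n" and q: "3 \<le> CARD('a::{field,finite})"
  shows "\<exists>K :: (nat \<Rightarrow> 'a) set. lines_and_parabolas n K id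
    \<and> lines_and_parabolas.\<alpha> n K id \<in> {0..n * rate CARD('a) n m}
    \<and> (real n - real m) * log 2 CARD('a) \<le> log 2 (card K)"
proof -
  have "\<exists>M\<in>mats m n. (\<Sum>p\<in>vecs n \<times> (vecs n :: (nat \<Rightarrow> 'a) set). log 2 (card {u \<in> {u \<in> vecs n. (fst p - snd p) * u = 0}.
        matvec m n M u = 0} / 1))
      \<le> n * log 2 CARD('a) * (\<Sum>p\<in>vecs n \<times> (vecs n :: (nat \<Rightarrow> 'a) set). 2 ^ agree n (fst p) (snd p)) / 2 ^ m"
  \<comment> \<open>Here \<open>w\<close> is the identity on vectors supported on the agreement set,
    and \<open>s = 1\<close>: typically only the zero vector survives.\<close>
  proof (rule exists_matrix_small_kernels[OF n q])
    fix p :: "(nat \<Rightarrow> 'a) \<times> (nat \<Rightarrow> 'a)"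
    have z: "{u \<in> {u \<in> vecs n. (fst p - snd p) * u = 0}. u = 0} = {0}"
      by auto
    show "{u \<in> {u \<in> vecs n. (fst p - snd p) * u = 0}. u = 0} \<noteq> {}" unfolding z by simp
    show "real (card {u \<in> {u \<in> vecs n. (fst p - snd p) * u = 0}. u = 0})
        + card {u \<in> vecs n. (fst p - snd p) * u = 0} / real CARD('a) ^ m
      \<le> 1 * (1 + real CARD('a) ^ agree n (fst p) (snd p) / real CARD('a) ^ m)"
      unfolding z card_supported_on_agreement by simp
    show "card {u \<in> vecs n. (fst p - snd p) * u = 0} \<le> 1 * real CARD('a) ^ n"
      unfolding card_supported_on_agreement using q by (simp add: agree_le power_increasing)
  qed auto
  then obtain M where M: "(\<Sum>p\<in>vecs n \<times> (vecs n :: (nat \<Rightarrow> 'a) set). log 2 (card {u \<in> {u \<in> vecs n. (fst p - snd p) * u = 0}.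
        matvec m n M u = 0} / 1))
      \<le> n * log 2 CARD('a) * (\<Sum>p\<in>vecs n \<times> (vecs n :: (nat \<Rightarrow> 'a) set). 2 ^ agree n (fst p) (snd p)) / 2 ^ m"
    by blast
  define K where "K = {v \<in> vecs n. matvec m n M v = 0}"
  have model: "lines_and_parabolas n K id"
    by standard (auto simp: K_def matvec_diff)
  let ?ambiguity = "lines_and_parabolas.ambiguity K id"
  have "{u \<in> {u \<in> vecs n. (fst p - snd p) * u = 0}. matvec m n M u = 0} = ?ambiguity (fst p) (snd p)"
    for p :: "(nat \<Rightarrow> 'a) \<times> (nat \<Rightarrow> 'a)"
    unfolding lines_and_parabolas.ambiguity_def[OF model] by (auto simp: K_def)
  then have "(\<Sum>(a, b)\<in>vecs n \<times> vecs n. log 2 (card (?ambiguity a b)))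
     \<le> n * rate CARD('a) n m * (real CARD('a) ^ n)\<^sup>2"
    using M sum_agree_pairs[of n, where 'a = 'a] by (simp add: case_prod_unfold rate_def mult_ac)
  then have "lines_and_parabolas.\<alpha> n K id \<le> n * rate CARD('a) n m"
    by (rule lines_and_parabolas.\<alpha>_le[OF model])
  moreover have "(real n - real m) * log 2 CARD('a) \<le> log 2 (card K)"
  proof -
    have "0 < card K" by (rule lines_and_parabolas.card_K_pos[OF model])
    moreover from this have "log 2 (real CARD('a) ^ n) \<le> log 2 (real CARD('a) ^ m * card K)"
      using card_matvec_kernel[of n m M] q unfolding K_def[symmetric]
      by (subst log_le_cancel_iff) simp_all
    ultimately show ?thesis by (simp add: log_mult log_nat_power algebra_simps)
  qed
  ultimately show ?thesis using model lines_and_parabolas.\<alpha>_nonneg[OF model] by auto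
qed

text \<open>A random matrix applied to the ordinates of \<open>A\<close>: whenever \<open>A\<close> and \<open>B\<close> coincide on few
  coordinates only, \<open>B\<close> carries no information on the hash.\<close>

lemma exists_independent_hash:
  assumes n: "1 \<le> n" and m: "m \<le> n" and q: "3 \<le> CARD('a::{field,finite})"
  shows "\<exists>g :: (nat \<Rightarrow> 'a) \<Rightarrow> nat \<Rightarrow> 'a. lines_and_parabolas n (vecs n) g
    \<and> lines_and_parabolas.\<alpha> n (vecs n) g \<le> m * log 2 CARD('a) + n * rate CARD('a) n m
    \<and> lines_and_parabolas.\<alpha> n (vecs n) g - log 2 (card (lines_and_parabolas.L n g))
       \<in> {0..n * rate CARD('a) n m}"
proof -
  let ?k = "n - m"
  let ?s = "real CARD('a) ^ m"
  have qn: "real CARD('a) ^ n = ?s * real CARD('a) ^ ?k" using m by (simp flip: power_add)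
  have "\<exists>M\<in>mats ?k n. (\<Sum>p\<in>vecs n \<times> (vecs n :: (nat \<Rightarrow> 'a) set). log 2 (card {u \<in> vecs n.
        matvec ?k n M ((fst p - snd p) * u) = 0} / ?s))
      \<le> n * log 2 CARD('a) * (\<Sum>p\<in>vecs n \<times> (vecs n :: (nat \<Rightarrow> 'a) set). 2 ^ agree n (fst p) (snd p)) / 2 ^ m"
  \<comment> \<open>Here \<open>u\<close> ranges over all vectors and \<open>s\<close> is
    \<open>q ^ n / q ^ (n - m)\<close>, the kernel size of a hash that is uniform given
    \<open>B\<close>.\<close>
  proof (rule exists_matrix_small_kernels[OF n q])
    fix p :: "(nat \<Rightarrow> 'a) \<times> (nat \<Rightarrow> 'a)"
    have "0 \<in> {u \<in> vecs n. (fst p - snd p) * u = 0}" by simp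
    then show "{u \<in> vecs n. (fst p - snd p) * u = 0} \<noteq> {}" by blast
    show "real (card {u \<in> vecs n. (fst p - snd p) * u = 0})
        + card (vecs n :: (nat \<Rightarrow> 'a) set) / real CARD('a) ^ ?k
      \<le> ?s * (1 + real CARD('a) ^ agree n (fst p) (snd p) / ?s)"
      unfolding card_supported_on_agreement by (simp add: card_vecs qn field_simps)
    have "1 \<le> ?s" using q by simp
    then show "card (vecs n :: (nat \<Rightarrow> 'a) set) \<le> ?s * real CARD('a) ^ n"
      by (simp add: card_vecs)
  qed auto
  then obtain M where M: "(\<Sum>p\<in>vecs n \<times> (vecs n :: (nat \<Rightarrow> 'a) set). log 2 (card {u \<in> vecs n.
        matvec ?k n M ((fst p - snd p) * u) = 0} / ?s))
      \<le> n * log 2 CARD('a) * (\<Sum>p\<in>vecs n \<times> (vecs n :: (nat \<Rightarrow> 'a) set). 2 ^ agree n (fst p) (snd p)) / 2 ^ m"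
    by blast
  define g where "g = matvec ?k n M"
  have model: "lines_and_parabolas n (vecs n) g"
    by standard (auto simp: g_def matvec_diff)
  let ?ambiguity = "lines_and_parabolas.ambiguity (vecs n) g"
  let ?L = "lines_and_parabolas.L n g"
  let ?Q = "(real CARD('a) ^ n)\<^sup>2"
  have "log 2 (card {u \<in> vecs n. matvec ?k n M ((fst p - snd p) * u) = 0} / ?s)
     = log 2 (card (?ambiguity (fst p) (snd p))) - m * log 2 CARD('a)" for p :: "(nat \<Rightarrow> 'a) \<times> (nat \<Rightarrow> 'a)"
    unfolding g_def[symmetric] lines_and_parabolas.ambiguity_def[OF model, symmetric]
    using lines_and_parabolas.card_ambiguity_pos[OF model] by (simp add: log_divide log_nat_power)
  then have "(\<Sum>(a, b)\<in>vecs n \<times> vecs n. log 2 (card (?ambiguity a b))) - m * log 2 CARD('a) * ?Q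
     \<le> n * rate CARD('a) n m * ?Q"
    using M sum_agree_pairs[of n, where 'a = 'a]
    by (simp add: case_prod_unfold rate_def sum_subtractf card_cartesian_product card_vecs
      power2_eq_square mult_ac)
  then have \<alpha>: "lines_and_parabolas.\<alpha> n (vecs n) g \<le> m * log 2 CARD('a) + n * rate CARD('a) n m"
    by (intro lines_and_parabolas.\<alpha>_le[OF model]) (simp add: algebra_simps)
  \<comment> \<open>The hash has only \<open>n - m\<close> rows, so its kernel contains at least
    \<open>q ^ m\<close> vectors.\<close>
  have L: "m * log 2 CARD('a) \<le> log 2 (card ?L)"
  proof -
    have "?s * real CARD('a) ^ ?k \<le> real CARD('a) ^ ?k * card ?L"
      using card_matvec_kernel[of n ?k M]
      unfolding g_def[symmetric] lines_and_parabolas.L_def[OF model, symmetric] qn .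
    then have "?s \<le> card ?L" by (simp add: mult.commute)
    then have "log 2 ?s \<le> log 2 (card ?L)"
      using lines_and_parabolas.card_L_pos[OF model] by (subst log_le_cancel_iff) auto
    then show ?thesis by (simp add: log_nat_power)
  qed
  show ?thesis
    using \<alpha> L model lines_and_parabolas.log_card_L_le_\<alpha>[OF model refl] by (intro exI[of _ g]) auto
qed

text \<open>The reason for \<open>n = 3 * m\<close> and \<open>q = 5\<close> on this side:
  \<open>(6 / 5) ^ 3 = 1.728 < 2\<close>.\<close>

lemma rate_tendsto: "(\<lambda>i. rate 5 (3 * Suc i) (Suc i)) \<longlonglongrightarrow> 0"
proof -
  have "rate 5 (3 * Suc i) (Suc i) = log 2 (real 5) * ((1 + 1 / real 5) ^ 3 / 2) ^ Suc i" for i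
    by (simp only: rate_def power_mult power_divide times_divide_eq_right)
  moreover have "(\<lambda>i. log 2 (real 5) * ((1 + 1 / real 5) ^ 3 / 2) ^ Suc i) \<longlonglongrightarrow> log 2 (real 5) * 0"
    by (intro tendsto_mult tendsto_const LIMSEQ_Suc LIMSEQ_power_zero) (simp add: power3_eq_cube)
  ultimately show ?thesis by (simp only: mult_zero_right)
qed

text \<open>Common to both claims. The last hypothesis bounds the loss by \<open>m * log 2 5\<close>
  up to a small error: either the slopes lose \<open>m\<close> dimensions and
  \<open>\<alpha>\<close> is small, or they are unrestricted and \<open>\<alpha>\<close> is about
  \<open>m * log 2 5\<close>.\<close>

lemma exists_limit_point:
  fixes K :: "nat \<Rightarrow> (nat \<Rightarrow> 'a::{field,finite}) set" and g :: "nat \<Rightarrow> (nat \<Rightarrow> 'a) \<Rightarrow> nat \<Rightarrow> 'a"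
  defines "e i S \<equiv> uniform_entropy (lines_and_parabolas.W (3 * Suc i) (K i))
    (lines_and_parabolas.X (g i)) S / (3 * Suc i)"
  assumes q: "CARD('a) = 5"
    and model: "\<And>i. lines_and_parabolas (3 * Suc i) (K i) (g i)"
    and \<alpha>: "\<And>i. 3 * Suc i * log 2 5 - log 2 (card (K i))
      + lines_and_parabolas.\<alpha> (3 * Suc i) (K i) (g i)
      \<le> Suc i * log 2 5 + 3 * Suc i * rate 5 (3 * Suc i) (Suc i)"
  obtains h :: "real ^ rvar neset" and r :: "nat \<Rightarrow> nat" where "h \<in> almost_entropic"
    and "strict_mono r" and "\<And>S. S \<noteq> {} \<Longrightarrow> (\<lambda>i. e (r i) S) \<longlonglongrightarrow> entr h S"
    and "cond_mut_inf h {A} {B} {C} = 0" and "ingleton_box h {A} {B} {C} {D} < 0"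
proof -
  have bound: "log 2 (card (lines_and_parabolas.W (3 * Suc i) (K i))) \<le> 5 * log 2 5 * real (3 * Suc i)" for i
    using lines_and_parabolas.log_card_W_le[OF model, of i] unfolding q by simp
  have "filterlim (\<lambda>i. 3 * Suc i) at_top sequentially"
    by (rule filterlim_at_top_mono[OF filterlim_ident]) auto
  then have "\<exists>h\<in>(almost_entropic :: (real ^ rvar neset) set). \<exists>r. strict_mono r \<and>
      (\<forall>S. S \<noteq> {} \<longrightarrow> (\<lambda>i. e (r i) S) \<longlonglongrightarrow> entr h S)"
    unfolding e_def
    by (intro almost_entropic_limit[OF _ _ bound] lines_and_parabolas.finite_W[OF model]
      lines_and_parabolas.W_nonempty[OF model]) auto
  then obtain h :: "real ^ rvar neset" and r :: "nat \<Rightarrow> nat" where h: "h \<in> almost_entropic"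
    and r: "strict_mono r" and lim: "\<And>S. S \<noteq> {} \<Longrightarrow> (\<lambda>i. e (r i) S) \<longlonglongrightarrow> entr h S"
    by blast
  have "e i {A, C} + e i {B, C} - e i {A, B, C} - e i {C} = 0" for i
    using lines_and_parabolas.cond_independence[OF model, of i]
    by (simp add: e_def flip: add_divide_distrib diff_divide_distrib)
  moreover have "(\<lambda>i. e (r i) {A, C} + e (r i) {B, C} - e (r i) {A, B, C} - e (r i) {C})
      \<longlonglongrightarrow> entr h {A, C} + entr h {B, C} - entr h {A, B, C} - entr h {C}"
    by (intro tendsto_intros lim) auto
  ultimately have cmi: "entr h {A, C} + entr h {B, C} - entr h {A, B, C} - entr h {C} = 0"
    by (simp add: LIMSEQ_const_iff)
  let ?box = "\<lambda>f. f {A, C} + f {A, D} + f {B, C} + f {B, D} + f {C, D}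
    - f {A, C, D} - f {B, C, D} - f {A, B} - f {C} - f {D} :: real"
  \<comment> \<open>The limiting bound per coordinate, with \<open>m / n = 1 / 3\<close> and
    \<open>q = 5\<close>.\<close>
  let ?c = "log 2 5 / 3 - (1 - 1 / 5) :: real"
  have "?box (e i) \<le> ?c + rate 5 (3 * Suc i) (Suc i)" for i
  proof -
    have "?box (uniform_entropy (lines_and_parabolas.W (3 * Suc i) (K i)) (lines_and_parabolas.X (g i)))
      \<le> Suc i * log 2 5 + 3 * Suc i * rate 5 (3 * Suc i) (Suc i) - 3 * Suc i * (1 - 1 / 5)"
      using lines_and_parabolas.ingleton_le[OF model, of i] \<alpha>[of i] unfolding q by simp
    also have "\<dots> = (?c + rate 5 (3 * Suc i) (Suc i)) * (3 * Suc i)"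
      by (simp add: field_simps)
    finally show ?thesis
      unfolding e_def add_divide_distrib[symmetric] diff_divide_distrib[symmetric]
      by (subst pos_divide_le_eq) auto
  qed
  moreover have "(\<lambda>i. ?box (e (r i))) \<longlonglongrightarrow> ?box (entr h)"
    by (intro tendsto_intros lim) auto
  moreover have "(\<lambda>i. ?c + rate 5 (3 * Suc (r i)) (Suc (r i))) \<longlonglongrightarrow> ?c + 0"
    using LIMSEQ_subseq_LIMSEQ[OF rate_tendsto r] by (intro tendsto_add tendsto_const) (simp add: o_def)
  ultimately have "?box (entr h) \<le> ?c + 0"
    by (intro LIMSEQ_le[of "\<lambda>i. ?box (e (r i))"]) auto
  moreover have "?c < 0"
  proof -
    \<comment> \<open>\<open>5 ^ 5 = 3125 < 4096 = 2 ^ 12\<close> gives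
      \<open>log 2 5 < 12 / 5\<close>, which is \<open>?c < 0\<close>.\<close>
    have "5 * log 2 5 = log 2 (5 ^ 5)" by (subst log_nat_power) auto
    also have "\<dots> < log 2 (2 ^ 12)" by (subst log_less_cancel_iff) auto
    also have "\<dots> = 12" by (subst log_nat_power) auto
    finally show ?thesis by simp
  qed
  ultimately have "?box (entr h) < 0" by linarith
  have unions: "{A} \<union> {C} = {A, C}" "{B} \<union> {C} = {B, C}" "{A} \<union> {B} = {A, B}"
    "{C} \<union> {A} = {A, C}" "{D} \<union> {A} = {A, D}" "{C} \<union> {B} = {B, C}" "{D} \<union> {B} = {B, D}"
    "{C} \<union> {D} = {C, D}" "{A, B} \<union> {C} = {A, B, C}" "{C, D} \<union> {A} = {A, C, D}"
    "{C, D} \<union> {B} = {B, C, D}"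
    by auto
  have "ingleton_box h {A} {B} {C} {D} < 0"
    using \<open>?box (entr h) < 0\<close>
    unfolding ingleton_box_def cond_mut_inf_def mut_inf_def unions by simp
  moreover have "cond_mut_inf h {A} {B} {C} = 0"
    unfolding cond_mut_inf_def unions by (rule cmi)
  ultimately show thesis using that h r lim by blast
qed

lemma LIMSEQ_0_of_squeeze:
  fixes x b :: "nat \<Rightarrow> real"
  assumes "x \<longlonglongrightarrow> l" "b \<longlonglongrightarrow> 0" "\<And>i. x i \<in> {0..b i}"
  shows "l = 0"
proof (rule LIMSEQ_unique[OF assms(1)])
  show "x \<longlonglongrightarrow> 0"
    by (rule tendsto_sandwich[OF _ _ tendsto_const assms(2)]) (use assms(3) in auto)
qed

text \<open>Five is prime, so \<open>five mod_ring\<close> is a field with five elements.\<close>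

typedef five = "{..<5::nat}"
  by (rule exI[of _ 0]) simp

lemma card_five: "CARD(five) = 5"
  using type_definition.card[OF type_definition_five] by simp

instance five :: prime_card
proof
  show "prime CARD(five)" unfolding card_five by simp
qed

theorem theorem5:
  shows
    "(\<exists>h \<in> (almost_entropic :: (real ^ rvar neset) set).
        cond_mut_inf h {A} {B} {C} = 0 \<and> mut_inf h {A} {B} = 0 \<and>
        ingleton_box h {A} {B} {C} {D} < 0) \<and>
     (\<exists>h \<in> (almost_entropic :: (real ^ rvar neset) set).
        cond_mut_inf h {A} {B} {C} = 0 \<and> cond_entr h {C} ({A} \<union> {B}) = 0 \<and>
        ingleton_box h {A} {B} {C} {D} < 0)"
proof
  have q: "CARD(five mod_ring) = 5" by (simp add: card_five)
  let ?\<rho> = "\<lambda>i. rate 5 (3 * Suc i) (Suc i)"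
  let ?V = "\<lambda>i. vecs (3 * Suc i) :: (nat \<Rightarrow> five mod_ring) set"
  have "\<forall>i. \<exists>g :: (nat \<Rightarrow> five mod_ring) \<Rightarrow> nat \<Rightarrow> five mod_ring. lines_and_parabolas (3 * Suc i) (?V i) g
    \<and> lines_and_parabolas.\<alpha> (3 * Suc i) (?V i) g \<le> Suc i * log 2 5 + (3 * Suc i) * ?\<rho> i
    \<and> lines_and_parabolas.\<alpha> (3 * Suc i) (?V i) g
      - log 2 (card (lines_and_parabolas.L (3 * Suc i) g)) \<in> {0..(3 * Suc i) * ?\<rho> i}"
    using exists_independent_hash[of "3 * Suc i" "Suc i" for i, where 'a = "five mod_ring"]
    unfolding q by simp
  from choice[OF this] obtain g where "\<forall>i. lines_and_parabolas (3 * Suc i) (?V i) (g i)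
    \<and> lines_and_parabolas.\<alpha> (3 * Suc i) (?V i) (g i) \<le> Suc i * log 2 5 + (3 * Suc i) * ?\<rho> i
    \<and> lines_and_parabolas.\<alpha> (3 * Suc i) (?V i) (g i)
      - log 2 (card (lines_and_parabolas.L (3 * Suc i) (g i))) \<in> {0..(3 * Suc i) * ?\<rho> i}" ..
  then have g: "\<And>i. lines_and_parabolas (3 * Suc i) (?V i) (g i)"
    and le: "\<And>i. lines_and_parabolas.\<alpha> (3 * Suc i) (?V i) (g i) \<le> Suc i * log 2 5 + (3 * Suc i) * ?\<rho> i"
    and L: "\<And>i. lines_and_parabolas.\<alpha> (3 * Suc i) (?V i) (g i)
      - log 2 (card (lines_and_parabolas.L (3 * Suc i) (g i))) \<in> {0..(3 * Suc i) * ?\<rho> i}"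
    by blast+
  show "\<exists>h \<in> (almost_entropic :: (real ^ rvar neset) set).
        cond_mut_inf h {A} {B} {C} = 0 \<and> mut_inf h {A} {B} = 0 \<and>
        ingleton_box h {A} {B} {C} {D} < 0"
  proof (rule exists_limit_point[OF q g])
    \<comment> \<open>Unrestricted slopes contribute no loss, so \<open>\<alpha>\<close> alone must
      meet the bound.\<close>
    have V: "log 2 (card (?V i)) = (3 * Suc i) * log 2 5" for i
      unfolding card_vecs q by (subst of_nat_power, subst log_nat_power) auto
    show "3 * Suc i * log 2 5 - log 2 (card (?V i)) + lines_and_parabolas.\<alpha> (3 * Suc i) (?V i) (g i)
      \<le> Suc i * log 2 5 + 3 * Suc i * ?\<rho> i" for i
      using le[of i] unfolding V by simp
    fix h :: "real ^ rvar neset" and r :: "nat \<Rightarrow> nat"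
    let ?e = "\<lambda>i S. uniform_entropy (lines_and_parabolas.W (3 * Suc i) (?V i))
      (lines_and_parabolas.X (g i)) S / (3 * Suc i)"
    assume h: "h \<in> almost_entropic" "cond_mut_inf h {A} {B} {C} = 0" "ingleton_box h {A} {B} {C} {D} < 0"
      and r: "strict_mono r" and lim: "\<And>S. S \<noteq> {} \<Longrightarrow> (\<lambda>i. ?e (r i) S) \<longlonglongrightarrow> entr h S"
    \<comment> \<open>With all slopes allowed, \<open>I(A:B)\<close> equals \<open>\<alpha>\<close>
      minus the logarithm of the kernel size of the hash.\<close>
    have "?e i {A} + ?e i {B} - ?e i {A, B} \<in> {0..?\<rho> i}" for i
      using lines_and_parabolas.mutual_information[OF g, of i] L[of i]
      unfolding add_divide_distrib[symmetric] diff_divide_distrib[symmetric] V q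
      by (simp add: pos_divide_le_eq mult.commute)
    moreover have "(\<lambda>i. ?e (r i) {A} + ?e (r i) {B} - ?e (r i) {A, B})
        \<longlonglongrightarrow> entr h {A} + entr h {B} - entr h {A, B}"
      by (intro tendsto_intros lim) auto
    ultimately have "entr h {A} + entr h {B} - entr h {A, B} = 0"
      using LIMSEQ_subseq_LIMSEQ[OF rate_tendsto r]
      by (intro LIMSEQ_0_of_squeeze[of _ _ "?\<rho> \<circ> r"]) auto
    then have "mut_inf h {A} {B} = 0" by (simp add: mut_inf_def insert_commute)
    with h show ?thesis by blast
  qed
  have "\<forall>i. \<exists>K :: (nat \<Rightarrow> five mod_ring) set. lines_and_parabolas (3 * Suc i) K id
    \<and> lines_and_parabolas.\<alpha> (3 * Suc i) K id \<in> {0..(3 * Suc i) * ?\<rho> i}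
    \<and> (real (3 * Suc i) - real (Suc i)) * log 2 5 \<le> log 2 (card K)"
    using exists_determined_line[of "3 * Suc i" "Suc i" for i, where 'a = "five mod_ring"]
    unfolding q by simp
  from choice[OF this] obtain K :: "nat \<Rightarrow> (nat \<Rightarrow> five mod_ring) set" where "\<forall>i. lines_and_parabolas (3 * Suc i) (K i) id
    \<and> lines_and_parabolas.\<alpha> (3 * Suc i) (K i) id \<in> {0..(3 * Suc i) * ?\<rho> i}
    \<and> (real (3 * Suc i) - real (Suc i)) * log 2 5 \<le> log 2 (card (K i))" ..
  then have K: "\<And>i. lines_and_parabolas (3 * Suc i) (K i) id"
    and \<alpha>: "\<And>i. lines_and_parabolas.\<alpha> (3 * Suc i) (K i) id \<in> {0..(3 * Suc i) * ?\<rho> i}"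
    and card_K: "\<And>i. (real (3 * Suc i) - real (Suc i)) * log 2 5 \<le> log 2 (card (K i))"
    by blast+
  show "\<exists>h \<in> (almost_entropic :: (real ^ rvar neset) set).
        cond_mut_inf h {A} {B} {C} = 0 \<and> cond_entr h {C} ({A} \<union> {B}) = 0 \<and>
        ingleton_box h {A} {B} {C} {D} < 0"
  proof (rule exists_limit_point[OF q K])
    \<comment> \<open>The slopes lose at most \<open>Suc i\<close> dimensions, and
      \<open>\<alpha>\<close> is within the error term.\<close>
    show "3 * Suc i * log 2 5 - log 2 (card (K i)) + lines_and_parabolas.\<alpha> (3 * Suc i) (K i) id
      \<le> Suc i * log 2 5 + 3 * Suc i * ?\<rho> i" for i
      using \<alpha>[of i] card_K[of i] by (simp add: algebra_simps)
    fix h :: "real ^ rvar neset" and r :: "nat \<Rightarrow> nat"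
    let ?e = "\<lambda>i S. uniform_entropy (lines_and_parabolas.W (3 * Suc i) (K i))
      (lines_and_parabolas.X id) S / (3 * Suc i)"
    assume h: "h \<in> almost_entropic" "cond_mut_inf h {A} {B} {C} = 0" "ingleton_box h {A} {B} {C} {D} < 0"
      and r: "strict_mono r" and lim: "\<And>S. S \<noteq> {} \<Longrightarrow> (\<lambda>i. ?e (r i) S) \<longlonglongrightarrow> entr h S"
    \<comment> \<open>This difference is \<open>\<alpha>\<close> divided by the number of
      coordinates.\<close>
    have "?e i {A, B, C} - ?e i {A, B} \<in> {0..?\<rho> i}" for i
      using lines_and_parabolas.cond_entropy[OF K, of i] \<alpha>[of i]
      unfolding diff_divide_distrib[symmetric]
      by (simp add: pos_divide_le_eq mult.commute)
    moreover have "(\<lambda>i. ?e (r i) {A, B, C} - ?e (r i) {A, B}) \<longlonglongrightarrow> entr h {A, B, C} - entr h {A, B}"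
      by (intro tendsto_intros lim) auto
    ultimately have "entr h {A, B, C} - entr h {A, B} = 0"
      using LIMSEQ_subseq_LIMSEQ[OF rate_tendsto r]
      by (intro LIMSEQ_0_of_squeeze[of _ _ "?\<rho> \<circ> r"]) auto
    moreover have "{C} \<union> ({A} \<union> {B}) = {A, B, C}" "{A} \<union> {B} = {A, B}" by auto
    ultimately have "cond_entr h {C} ({A} \<union> {B}) = 0" by (simp add: cond_entr_def)
    with h show ?thesis by blast
  qed
qed

end
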